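(* When parameterized by the number $\tau$ of voting profiles, CMPV and RMPV are both contained in XP.
   Context: An instance of CMPV or RMPV consists of a set of agents $A$, a set of candidates $C$, a sequence $U=(u_1,\dots,u_\tau)$ of voting profiles with $u_t\colon A\to C\cup\{\emptyset\}$, and integers $k\in\mathbb{N}$, $\ell\in\mathbb{N}_0$, $x\in\mathbb{N}$. For $C'\subseteq C$ let $\mathrm{score}_t(C')=|u_t^{-1}(C')|$. The question is whether there is a sequence $(C_1,\dots,C_\tau)$ of committees $C_t\subseteq C$ with $|C_t|\le k$ and $\mathrm{score}_t(C_t)\ge x$ for all $t$, and for all $t\in\{1,\dots,\tau-1\}$: $|C_t\triangle C_{t+1}|\le \ell$ (CMPV), respectively $|C_t\triangle C_{t+1}|\ge \ell$ (RMPV). XP means solvable in time $|I|^{f(\tau)}$ for some computable function $f$. *)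

theory Defs
  imports Main
begin

text \<open>
  Model of computation: a random access machine with uniform cost measure whose only arithmetic
  operations are addition and (truncated) subtraction, so that running times are polynomially
  related to those of Turing machines. Instructions act on registers; the memory, which initially
  holds the input, is addressed indirectly through registers.
\<close>

datatype instr =
    Const nat nat
  | Add nat nat nat
  | Sub nat nat nat
  | Load nat nat
  | Store nat nat
  | Jump nat
  | JumpZ nat nat

record config =
  pc :: nat
  reg :: "nat \<Rightarrow> nat"
  mem :: "nat \<Rightarrow> nat"

fun exec_instr :: "instr \<Rightarrow> config \<Rightarrow> config" where
  "exec_instr (Const r n) c = c\<lparr>pc := pc c + 1, reg := (reg c)(r := n)\<rparr>"
| "exec_instr (Add r s t) c = c\<lparr>pc := pc c + 1, reg := (reg c)(r := reg c s + reg c t)\<rparr>"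
| "exec_instr (Sub r s t) c = c\<lparr>pc := pc c + 1, reg := (reg c)(r := reg c s - reg c t)\<rparr>"
| "exec_instr (Load r s) c = c\<lparr>pc := pc c + 1, reg := (reg c)(r := mem c (reg c s))\<rparr>"
| "exec_instr (Store r s) c = c\<lparr>pc := pc c + 1, mem := (mem c)(reg c r := reg c s)\<rparr>"
| "exec_instr (Jump l) c = c\<lparr>pc := l\<rparr>"
| "exec_instr (JumpZ r l) c = c\<lparr>pc := (if reg c r = 0 then l else pc c + 1)\<rparr>"

definition halted :: "instr list \<Rightarrow> config \<Rightarrow> bool" where
  "halted p c \<longleftrightarrow> pc c \<ge> length p"

definition step :: "instr list \<Rightarrow> config \<Rightarrow> config" where
  "step p c = (if halted p c then c else exec_instr (p ! pc c) c)"

definition run :: "instr list \<Rightarrow> nat \<Rightarrow> config \<Rightarrow> config" where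
  "run p n c = (step p ^^ n) c"

text \<open>Number arguments are passed, and results returned, in register 0.\<close>

definition init_nat :: "nat \<Rightarrow> config" where
  "init_nat n = \<lparr>pc = 0, reg = (\<lambda>_. 0)(0 := n), mem = (\<lambda>_. 0)\<rparr>"

definition computable :: "(nat \<Rightarrow> nat) \<Rightarrow> bool" where
  "computable f \<longleftrightarrow> (\<exists>p. \<forall>n. \<exists>t.
     halted p (run p t (init_nat n)) \<and> reg (run p t (init_nat n)) 0 = f n)"

text \<open>A word is stored one bit per memory cell, and its length is given in register 0.\<close>

definition init_word :: "bool list \<Rightarrow> config" where
  "init_word w = \<lparr>pc = 0, reg = (\<lambda>_. 0)(0 := length w),
     mem = (\<lambda>i. if i < length w then of_bool (w ! i) else 0)\<rparr>"

text \<open>Since \<^const>\<open>step\<close> leaves halted configurations unchanged, this says that the program halts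
  after at most \<open>t\<close> steps; a non-zero value in register 0 means acceptance.\<close>

definition answers_within :: "instr list \<Rightarrow> bool list \<Rightarrow> nat \<Rightarrow> bool \<Rightarrow> bool" where
  "answers_within p w t b \<longleftrightarrow>
     halted p (run p t (init_word w)) \<and> (reg (run p t (init_word w)) 0 \<noteq> 0 \<longleftrightarrow> b)"

record 'i param_problem =
  instances :: "'i set"
  encoding :: "'i \<Rightarrow> bool list"
  parameter :: "'i \<Rightarrow> nat"
  yes_instances :: "'i set"

definition XP :: "'i param_problem set" where
  "XP = {P. \<exists>p f. computable f \<and>
     (\<forall>I \<in> instances P.
        answers_within p (encoding P I) (length (encoding P I) ^ f (parameter P I))
          (I \<in> yes_instances P))}"

text \<open>Agents and candidates are named by natural numbers; \<^const>\<open>None\<close> is the empty vote.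
  Values of a profile outside the set of agents are irrelevant.\<close>

record mpv =
  agents :: "nat set"
  candidates :: "nat set"
  profiles :: "(nat \<Rightarrow> nat option) list"
  k_bound :: nat
  l_bound :: nat
  x_bound :: nat

definition mpv_instance :: "mpv \<Rightarrow> bool" where
  "mpv_instance I \<longleftrightarrow>
     finite (agents I) \<and> finite (candidates I) \<and> profiles I \<noteq> [] \<and>
     (\<forall>u \<in> set (profiles I). u ` agents I \<subseteq> insert None (Some ` candidates I)) \<and>
     k_bound I \<ge> 1 \<and> x_bound I \<ge> 1"

definition score :: "mpv \<Rightarrow> nat \<Rightarrow> nat set \<Rightarrow> nat" where
  "score I t C' = card {a \<in> agents I. (profiles I ! t) a \<in> Some ` C'}"

definition committees :: "mpv \<Rightarrow> nat set list \<Rightarrow> bool" where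
  "committees I Cs \<longleftrightarrow>
     length Cs = length (profiles I) \<and>
     (\<forall>t < length (profiles I).
        Cs ! t \<subseteq> candidates I \<and> card (Cs ! t) \<le> k_bound I \<and> score I t (Cs ! t) \<ge> x_bound I)"

definition cmpv_yes :: "mpv \<Rightarrow> bool" where
  "cmpv_yes I \<longleftrightarrow> (\<exists>Cs. committees I Cs \<and>
     (\<forall>t. Suc t < length (profiles I) \<longrightarrow> card (sym_diff (Cs ! t) (Cs ! Suc t)) \<le> l_bound I))"

definition rmpv_yes :: "mpv \<Rightarrow> bool" where
  "rmpv_yes I \<longleftrightarrow> (\<exists>Cs. committees I Cs \<and>
     (\<forall>t. Suc t < length (profiles I) \<longrightarrow> card (sym_diff (Cs ! t) (Cs ! Suc t)) \<ge> l_bound I))"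

text \<open>Most significant digit first, without leading zeros.\<close>

fun binary :: "nat \<Rightarrow> bool list" where
  "binary n = (if n = 0 then [] else binary (n div 2) @ [odd n])"

declare binary.simps [simp del]

text \<open>Self-delimiting binary code: every digit is preceded by a 1, and a 0 marks the end.\<close>

definition encode_nat :: "nat \<Rightarrow> bool list" where
  "encode_nat n = concat (map (\<lambda>b. [True, b]) (binary n)) @ [False]"

definition encode_vote :: "nat option \<Rightarrow> nat" where
  "encode_vote v = (case v of None \<Rightarrow> 0 | Some c \<Rightarrow> Suc c)"

definition encode_mpv :: "mpv \<Rightarrow> bool list" where
  "encode_mpv I = concat (map encode_nat (
     card (agents I) # sorted_list_of_set (agents I) @
     card (candidates I) # sorted_list_of_set (candidates I) @
     length (profiles I) #
     concat (map (\<lambda>u. map (\<lambda>a. encode_vote (u a)) (sorted_list_of_set (agents I))) (profiles I)) @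
     [k_bound I, l_bound I, x_bound I]))"

definition CMPV :: "mpv param_problem" where
  "CMPV = \<lparr>instances = {I. mpv_instance I}, encoding = encode_mpv,
     parameter = (\<lambda>I. length (profiles I)), yes_instances = {I. mpv_instance I \<and> cmpv_yes I}\<rparr>"

definition RMPV :: "mpv param_problem" where
  "RMPV = \<lparr>instances = {I. mpv_instance I}, encoding = encode_mpv,
     parameter = (\<lambda>I. length (profiles I)), yes_instances = {I. mpv_instance I \<and> rmpv_yes I}\<rparr>"

end

theory Submission imports Defs begin

text \<open>
  Decide for every candidate and every committee, candidate by candidate, whether the candidate is a
  member. Apart from the last decision only the sizes and scores of the committees and the sizes of
  the symmetric differences built up so far matter. All of them are smaller than the input length
  \<open>N\<close>, so they are the digits of a number in base \<open>N\<close> with \<open>3 * \<tau>\<close> digits, and a decision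
  adds to that number. Marking the reachable numbers is a dynamic program with \<open>2 * N ^ (3 * \<tau>)\<close>
  cells per decision; the bounds on the digits are tested at the end. Checking a digit by repeated
  subtraction keeps the running time below the cube of \<open>N ^ (3 * \<tau>)\<close> up to a constant factor.
\<close>

section \<open>A structured language compiled to the machine\<close>

datatype com =
    Skip
  | Basic instr
  | Seq com com (infixr ";;" 60)
  | If nat com com
  | While nat com

fun is_basic :: "instr \<Rightarrow> bool" where
  "is_basic (Jump l) = False"
| "is_basic (JumpZ r l) = False"
| "is_basic i = True"

fun basic_reg :: "instr \<Rightarrow> (nat \<Rightarrow> nat) \<Rightarrow> (nat \<Rightarrow> nat) \<Rightarrow> nat \<Rightarrow> nat" where
  "basic_reg (Const d n) r m = r(d := n)"
| "basic_reg (Add d s t) r m = r(d := r s + r t)"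
| "basic_reg (Sub d s t) r m = r(d := r s - r t)"
| "basic_reg (Load d s) r m = r(d := m (r s))"
| "basic_reg i r m = r"

fun basic_mem :: "instr \<Rightarrow> (nat \<Rightarrow> nat) \<Rightarrow> (nat \<Rightarrow> nat) \<Rightarrow> nat \<Rightarrow> nat" where
  "basic_mem (Store d s) r m = m(r d := r s)"
| "basic_mem i r m = m"

inductive big_step ::
  "com \<Rightarrow> (nat \<Rightarrow> nat) \<Rightarrow> (nat \<Rightarrow> nat) \<Rightarrow> nat \<Rightarrow> (nat \<Rightarrow> nat) \<Rightarrow> (nat \<Rightarrow> nat) \<Rightarrow> bool" where
  Skip: "big_step Skip r m 0 r m"
| Basic: "is_basic i \<Longrightarrow> big_step (Basic i) r m 1 (basic_reg i r m) (basic_mem i r m)"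
| Seq: "big_step c r m n r' m' \<Longrightarrow> big_step d r' m' n' r'' m'' \<Longrightarrow> big_step (c ;; d) r m (n + n') r'' m''"
| IfNZ: "r x \<noteq> 0 \<Longrightarrow> big_step c r m n r' m' \<Longrightarrow> big_step (If x c d) r m (n + 2) r' m'"
| IfZ: "r x = 0 \<Longrightarrow> big_step d r m n r' m' \<Longrightarrow> big_step (If x c d) r m (n + 1) r' m'"
| WhileZ: "r x = 0 \<Longrightarrow> big_step (While x c) r m 1 r m"
| WhileNZ: "r x \<noteq> 0 \<Longrightarrow> big_step c r m n r' m' \<Longrightarrow> big_step (While x c) r' m' n' r'' m'' \<Longrightarrow>
    big_step (While x c) r m (n + n' + 2) r'' m''"

inductive_cases SkipE: "big_step Skip r m n r' m'"
inductive_cases BasicE: "big_step (Basic i) r m n r' m'"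
inductive_cases SeqE: "big_step (c ;; d) r m n r' m'"
inductive_cases IfE: "big_step (If x c d) r m n r' m'"

fun code_size :: "com \<Rightarrow> nat" where
  "code_size Skip = 0"
| "code_size (Basic i) = 1"
| "code_size (c ;; d) = code_size c + code_size d"
| "code_size (If x c d) = code_size c + code_size d + 2"
| "code_size (While x c) = code_size c + 2"

fun compile :: "nat \<Rightarrow> com \<Rightarrow> instr list" where
  "compile p Skip = []"
| "compile p (Basic i) = [i]"
| "compile p (c ;; d) = compile p c @ compile (p + code_size c) d"
| "compile p (If x c d) = JumpZ x (p + code_size c + 2) # compile (p + 1) c
     @ Jump (p + code_size c + code_size d + 2) # compile (p + code_size c + 2) d"
| "compile p (While x c) = JumpZ x (p + code_size c + 2) # compile (p + 1) c @ [Jump p]"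

lemma length_compile [simp]: "length (compile p c) = code_size c"
  by (induction c arbitrary: p) auto

definition code_at :: "instr list \<Rightarrow> nat \<Rightarrow> instr list \<Rightarrow> bool" where
  "code_at P p xs \<longleftrightarrow> (\<forall>i < length xs. p + i < length P \<and> P ! (p + i) = xs ! i)"

lemma code_at_Cons [simp]:
  "code_at P p (x # xs) \<longleftrightarrow> p < length P \<and> P ! p = x \<and> code_at P (Suc p) xs"
  unfolding code_at_def by (auto simp: All_less_Suc2)

lemma code_at_Nil [simp]: "code_at P p []"
  by (simp add: code_at_def)

lemma code_at_append [simp]:
  "code_at P p (xs @ ys) \<longleftrightarrow> code_at P p xs \<and> code_at P (p + length xs) ys"
  by (induction xs arbitrary: p) auto

lemma run_add: "run P (n + n') c = run P n' (run P n c)"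
  by (simp add: run_def funpow_add add.commute[of n])

lemma run_Suc: "run P (Suc n) c = run P n (step P c)"
  by (simp add: run_def funpow_swap1)

lemma run_0 [simp]: "run P 0 c = c"
  by (simp add: run_def)

abbreviation cfg :: "nat \<Rightarrow> (nat \<Rightarrow> nat) \<Rightarrow> (nat \<Rightarrow> nat) \<Rightarrow> config" where
  "cfg p r m \<equiv> \<lparr>pc = p, reg = r, mem = m\<rparr>"

lemma compile_correct:
  "big_step c r m n r' m' \<Longrightarrow> code_at P p (compile p c) \<Longrightarrow>
     run P n (cfg p r m) = cfg (p + code_size c) r' m'"
proof (induction arbitrary: p rule: big_step.induct)
  case (Basic i r m)
  then show ?case
    by (cases i) (auto simp: run_Suc step_def halted_def)
next
  case (Seq c r m n r' m' d n' r'' m'')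
  then show ?case by (simp add: run_add add.assoc)
next
  case (IfNZ r x c m n r' m' d)
  have "run P (1 + (n + 1)) (cfg p r m) = cfg (p + code_size (If x c d)) r' m'"
    using IfNZ by (simp only: run_add) (simp add: run_Suc step_def halted_def)
  then show ?case by (simp add: add.commute)
next
  case (IfZ r x d m n r' m' c)
  have "run P (1 + n) (cfg p r m) = cfg (p + code_size (If x c d)) r' m'"
    using IfZ by (simp only: run_add) (simp add: run_Suc step_def halted_def)
  then show ?case by (simp add: add.commute)
next
  case (WhileZ r x c m)
  then show ?case by (simp add: run_Suc step_def halted_def)
next
  case (WhileNZ r x c m n r' m' n' r'' m'')
  have "run P (1 + (n + (1 + n'))) (cfg p r m) = cfg (p + code_size (While x c)) r'' m''"
    using WhileNZ.prems WhileNZ.hyps WhileNZ.IH(1)[of "Suc p"] WhileNZ.IH(2)[of p]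
    by (simp only: run_add) (simp add: run_Suc step_def halted_def)
  then show ?case by (simp add: add_ac)
qed simp

lemma run_halted: "halted P c \<Longrightarrow> run P n c = c"
  by (induction n) (auto simp: run_Suc step_def)

definition wp :: "com \<Rightarrow> (nat \<Rightarrow> (nat \<Rightarrow> nat) \<Rightarrow> (nat \<Rightarrow> nat) \<Rightarrow> bool) \<Rightarrow>
    (nat \<Rightarrow> nat) \<Rightarrow> (nat \<Rightarrow> nat) \<Rightarrow> bool" where
  "wp c Q r m \<longleftrightarrow> (\<exists>n r' m'. big_step c r m n r' m' \<and> Q n r' m')"

lemma wp_Skip [simp]: "wp Skip Q r m \<longleftrightarrow> Q 0 r m"
  unfolding wp_def by (auto elim: SkipE intro: big_step.intros)

lemma wp_Basic [simp]:
  "wp (Basic i) Q r m \<longleftrightarrow> is_basic i \<and> Q 1 (basic_reg i r m) (basic_mem i r m)"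
  unfolding wp_def by (auto elim!: BasicE intro: big_step.Basic[simplified])

lemma wp_Seq [simp]:
  "wp (c ;; d) Q r m \<longleftrightarrow> wp c (\<lambda>n. wp d (\<lambda>n'. Q (n + n'))) r m"
  unfolding wp_def by (blast elim: SeqE intro: big_step.Seq)

lemma wp_If [simp]:
  "wp (If x c d) Q r m \<longleftrightarrow>
     (if r x \<noteq> 0 then wp c (\<lambda>n. Q (n + 2)) r m else wp d (\<lambda>n. Q (n + 1)) r m)"
  unfolding wp_def by (auto elim!: IfE intro: big_step.IfZ[simplified] big_step.IfNZ[simplified])

fun writes :: "com \<Rightarrow> nat set" where
  "writes Skip = {}"
| "writes (Basic i) = (case i of Const d n \<Rightarrow> {d} | Add d s t \<Rightarrow> {d} | Sub d s t \<Rightarrow> {d}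
     | Load d s \<Rightarrow> {d} | _ \<Rightarrow> {})"
| "writes (c ;; d) = writes c \<union> writes d"
| "writes (If x c d) = writes c \<union> writes d"
| "writes (While x c) = writes c"

lemma big_step_frame: "big_step c r m n r' m' \<Longrightarrow> x \<notin> writes c \<Longrightarrow> r' x = r x"
proof (induction rule: big_step.induct)
  case (Basic i r m)
  then show ?case by (cases i) auto
qed auto

lemma wp_mono:
  assumes "wp c Q' r m"
    and "\<And>n r' m'. Q' n r' m' \<Longrightarrow> (\<And>x. x \<notin> writes c \<Longrightarrow> r' x = r x) \<Longrightarrow> Q n r' m'"
  shows "wp c Q r m"
  using assms big_step_frame unfolding wp_def by metis

lemma wp_While:
  assumes body: "\<And>i r' m'. i < k \<Longrightarrow> I i r' m' \<Longrightarrow> (\<And>y. y \<notin> writes c \<Longrightarrow> r' y = r y) \<Longrightarrow>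
      r' x \<noteq> 0 \<and> wp c (\<lambda>n r'' m''. n \<le> T \<and> I (Suc i) r'' m'') r' m'"
    and exit: "\<And>r m. I k r m \<Longrightarrow> r x = 0"
    and init: "I 0 r m"
  shows "wp (While x c) (\<lambda>n r' m'. n \<le> k * (T + 2) + 1 \<and> I k r' m') r m"
proof -
  have "wp (While x c) (\<lambda>n r'' m''. n \<le> i * (T + 2) + 1 \<and> I k r'' m'') r' m'"
    if "i \<le> k" "I (k - i) r' m'" "\<And>y. y \<notin> writes c \<Longrightarrow> r' y = r y" for i r' m'
    using that
  proof (induction i arbitrary: r' m')
    case 0
    then show ?case using exit[of r' m'] big_step.WhileZ[of r' x c m'] by (fastforce simp: wp_def)
  next
    case (Suc i)
    have k: "k - Suc i < k" "Suc (k - Suc i) = k - i" using Suc.prems by auto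
    from body[OF k(1) Suc.prems(2,3)] obtain n r1 m1 where 1:
      "r' x \<noteq> 0" "big_step c r' m' n r1 m1" "n \<le> T" "I (k - i) r1 m1"
      unfolding wp_def k(2) by auto
    have "r1 y = r y" if "y \<notin> writes c" for y
      using big_step_frame[OF 1(2) that] Suc.prems(3)[OF that] by simp
    from Suc.IH[OF _ 1(4) this] Suc.prems(1) obtain n' r2 m2 where 2:
      "big_step (While x c) r1 m1 n' r2 m2" "n' \<le> i * (T + 2) + 1" "I k r2 m2"
      unfolding wp_def by auto
    show ?case
      using big_step.WhileNZ[OF 1(1,2) 2(1)] 1 2 unfolding wp_def
      by (intro exI[of _ "n + n' + 2"] exI[of _ r2] exI[of _ m2]) auto
  qed
  from this[of k r m] init show ?thesis by simp
qed

section \<open>Decoding the input\<close>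

text \<open>Memory layout, with \<open>N\<close> the length of the input: the input bits in the cells below \<open>N\<close>, the
  decoded numbers from \<open>N\<close> on (fewer than \<open>N\<close> of them), the dynamic programming table from \<open>2 * N\<close> on.\<close>

abbreviation (input) rN :: nat where "rN \<equiv> 2"
abbreviation (input) rOne :: nat where "rOne \<equiv> 3"
abbreviation (input) rPos :: nat where "rPos \<equiv> 4"
abbreviation (input) rOut :: nat where "rOut \<equiv> 5"
abbreviation (input) rRem :: nat where "rRem \<equiv> 6"
abbreviation (input) rV :: nat where "rV \<equiv> 7"
abbreviation (input) rBit :: nat where "rBit \<equiv> 8"
abbreviation (input) rDig :: nat where "rDig \<equiv> 9"
abbreviation (input) rA :: nat where "rA \<equiv> 10"
abbreviation (input) rM :: nat where "rM \<equiv> 11"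
abbreviation (input) rCB :: nat where "rCB \<equiv> 12"
abbreviation (input) rTau :: nat where "rTau \<equiv> 13"
abbreviation (input) rVB :: nat where "rVB \<equiv> 14"
abbreviation (input) rKP :: nat where "rKP \<equiv> 15"
abbreviation (input) rK :: nat where "rK \<equiv> 16"
abbreviation (input) rL :: nat where "rL \<equiv> 17"
abbreviation (input) rX :: nat where "rX \<equiv> 18"
abbreviation (input) rW :: nat where "rW \<equiv> 19"
abbreviation (input) rP :: nat where "rP \<equiv> 20"
abbreviation (input) rCC :: nat where "rCC \<equiv> 21"
abbreviation (input) rCP :: nat where "rCP \<equiv> 22"
abbreviation (input) rCand :: nat where "rCand \<equiv> 23"
abbreviation (input) rVP :: nat where "rVP \<equiv> 24"
abbreviation (input) rWt :: nat where "rWt \<equiv> 25"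
abbreviation (input) rG :: nat where "rG \<equiv> 26"
abbreviation (input) rD :: nat where "rD \<equiv> 27"
abbreviation (input) rTC :: nat where "rTC \<equiv> 28"
abbreviation (input) rAC :: nat where "rAC \<equiv> 29"
abbreviation (input) rE0 :: nat where "rE0 \<equiv> 30"
abbreviation (input) rE1 :: nat where "rE1 \<equiv> 31"
abbreviation (input) rSC :: nat where "rSC \<equiv> 32"
abbreviation (input) rQ :: nat where "rQ \<equiv> 33"
abbreviation (input) rS :: nat where "rS \<equiv> 34"
abbreviation (input) rY :: nat where "rY \<equiv> 35"
abbreviation (input) rOk :: nat where "rOk \<equiv> 36"
abbreviation (input) rF :: nat where "rF \<equiv> 37"
abbreviation (input) rAns :: nat where "rAns \<equiv> 38"
abbreviation (input) rCnt :: nat where "rCnt \<equiv> 39"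
abbreviation (input) rXX :: nat where "rXX \<equiv> 40"
abbreviation (input) rRes :: nat where "rRes \<equiv> 41"

definition copy :: "nat \<Rightarrow> nat \<Rightarrow> com" where
  "copy d s = Basic (Const d 0) ;; Basic (Add d d s)"

lemma wp_copy [simp]: "d \<noteq> s \<Longrightarrow> wp (copy d s) Q r m \<longleftrightarrow> Q 2 (r(d := r s)) m"
  by (simp add: copy_def numeral_2_eq_2)

lemma writes_copy [simp]: "writes (copy d s) = {d}"
  by (simp add: copy_def)

definition mul :: "nat \<Rightarrow> com" where
  "mul x = Basic (Const rY 0) ;; copy rCnt rN ;;
     While rCnt (Basic (Add rY rY x) ;; Basic (Sub rCnt rCnt rOne)) ;; copy x rY"

lemma writes_mul [simp]: "writes (mul x) = {rY, rCnt, x}"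
  by (auto simp: mul_def)

lemma wp_mul:
  assumes "x \<notin> {rY, rCnt, rN, rOne}" "r rOne = 1"
  shows "wp (mul x) (\<lambda>n r' m'. n \<le> 4 * r rN + 6 \<and> r' x = r x * r rN \<and> m' = m) r m"
  using assms unfolding mul_def
  apply simp
  apply (rule wp_mono[OF wp_While[where k="r rN" and T=2 and
      I="\<lambda>i r' m'. r' rY = i * r x \<and> r' rCnt = r rN - i \<and> m' = m"]])
  by auto

definition parse_nat :: com where
  "parse_nat = Basic (Const rV 0) ;; Basic (Load rBit rPos) ;; Basic (Add rPos rPos rOne) ;;
     While rBit (Basic (Load rDig rPos) ;; Basic (Add rPos rPos rOne) ;;
       Basic (Add rV rV rV) ;; Basic (Add rV rV rDig) ;;
       Basic (Load rBit rPos) ;; Basic (Add rPos rPos rOne))"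

lemma writes_parse_nat [simp]: "writes parse_nat = {rV, rBit, rPos, rDig}"
  by (auto simp: parse_nat_def)

abbreviation bits_value :: "bool list \<Rightarrow> nat" where
  "bits_value \<equiv> foldl (\<lambda>v b. 2 * v + of_bool b) 0"

lemma bits_value_binary: "bits_value (binary n) = n"
proof (induction n rule: binary.induct)
  case (1 n)
  show ?case
  proof (cases "n = 0")
    case False
    with 1 have "bits_value (binary n) = 2 * (n div 2) + of_bool (odd n)"
      by (subst binary.simps) simp
    then show ?thesis by simp
  qed (simp add: binary.simps)
qed

lemma length_encode_nat: "length (encode_nat n) = 2 * length (binary n) + 1"
proof -
  have "length (concat (map (\<lambda>b. [True, b]) bs)) = 2 * length bs" for bs
    by (induction bs) auto
  then show ?thesis by (simp add: encode_nat_def)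
qed

lemma encode_nat_nth:
  assumes "i \<le> length (binary n)"
  shows "encode_nat n ! (2 * i) \<longleftrightarrow> i < length (binary n)"
    and "i < length (binary n) \<Longrightarrow> encode_nat n ! (Suc (2 * i)) = binary n ! i"
proof -
  have "(concat (map (\<lambda>b. [True, b]) bs) @ [False]) ! (2 * i) \<longleftrightarrow> i < length bs"
    if "i \<le> length bs" for bs
    using that
  proof (induction bs arbitrary: i)
    case (Cons b bs)
    then show ?case by (cases i) auto
  qed simp
  then show "encode_nat n ! (2 * i) \<longleftrightarrow> i < length (binary n)"
    using assms by (simp add: encode_nat_def)
  have "(concat (map (\<lambda>b. [True, b]) bs) @ [False]) ! (Suc (2 * i)) = bs ! i"
    if "i < length bs" for bs
    using that by (induction bs arbitrary: i) (auto simp: less_Suc_eq_0_disj)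
  then show "i < length (binary n) \<Longrightarrow> encode_nat n ! (Suc (2 * i)) = binary n ! i"
    by (simp add: encode_nat_def)
qed

lemma wp_parse_nat:
  assumes "r rOne = 1" "\<And>i. i < length (encode_nat v) \<Longrightarrow> m (r rPos + i) = of_bool (encode_nat v ! i)"
  shows "wp parse_nat (\<lambda>n r' m'. n \<le> 8 * length (binary v) + 4 \<and> r' rV = v \<and>
    r' rPos = r rPos + length (encode_nat v) \<and> m' = m) r m"
proof -
  define k where "k = length (binary v)"
  have m: "m (r rPos + 2 * i) = of_bool (i < k)" if "i \<le> k" for i
    using assms(2)[of "2 * i"] encode_nat_nth(1)[of i v] that by (auto simp: length_encode_nat k_def)
  have m': "m (Suc (r rPos + 2 * i)) = of_bool (binary v ! i)" if "i < k" for i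
    using assms(2)[of "Suc (2 * i)"] encode_nat_nth(2)[of i v] that by (auto simp: length_encode_nat k_def)
  show ?thesis
    using assms(1) unfolding parse_nat_def
    apply simp
    apply (rule wp_mono[OF wp_While[where k=k and T=6 and
       I="\<lambda>i r' m'. r' rV = bits_value (take i (binary v)) \<and> r' rPos = Suc (r rPos + 2 * i) \<and>
         r' rBit = of_bool (i < k) \<and> m' = m"]])
    subgoal for i r' m'
      using m[of "Suc i"] m'[of i] by (auto simp: take_Suc_conv_app_nth k_def)
    subgoal by simp
    subgoal using m[of 0] by simp
    subgoal by (auto simp: k_def bits_value_binary length_encode_nat)
    done
qed

definition parse :: com where
  "parse = copy rN 0 ;; Basic (Const rOne 1) ;; Basic (Const rPos 0) ;; copy rOut rN ;; copy rRem rN ;;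
     While rRem (parse_nat ;; Basic (Store rOut rV) ;; Basic (Add rOut rOut rOne) ;;
       Basic (Sub rRem rN rPos))"

lemma wp_parse:
  fixes xs :: "nat list"
  defines "w \<equiv> concat (map encode_nat xs)"
  assumes "r 0 = length w" and m: "\<And>i. i < length w \<Longrightarrow> m i = of_bool (w ! i)"
  shows "wp parse (\<lambda>n r' m'. n \<le> length w * (8 * length w + 9) + 9 \<and> r' rN = length w \<and> r' rOne = 1 \<and>
    m' = (\<lambda>i. if length w \<le> i \<and> i < length w + length xs then xs ! (i - length w) else m i)) r m"
proof -
  define pos where "pos j = length (concat (map encode_nat (take j xs)))" for j
  have ps: "pos (Suc j) = pos j + length (encode_nat (xs ! j))" if "j < length xs" for j
    using that by (simp add: pos_def take_Suc_conv_app_nth)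
  have pe: "pos (length xs) = length w" by (simp add: pos_def w_def)
  have p0: "pos 0 = 0" by (simp add: pos_def)
  have split: "w = concat (map encode_nat (take j xs)) @ encode_nat (xs ! j) @
      concat (map encode_nat (drop (Suc j) xs))" if "j < length xs" for j
    unfolding w_def by (subst id_take_nth_drop[OF that]) simp
  have wn: "w ! (pos j + i) = encode_nat (xs ! j) ! i"
    if "j < length xs" "i < length (encode_nat (xs ! j))" for i j
    using that by (subst split[OF that(1)]) (simp add: nth_append pos_def)
  have pl: "pos (Suc j) \<le> length w" if "j < length xs" for j
    using that by (subst split[OF that(1)]) (simp add: ps, simp add: pos_def)
  have lx: "length xs \<le> length w"
    unfolding w_def by (induction xs) (auto simp: length_encode_nat)
  have fin: "pos j < length w" if "j < length xs" for j
    using pl[OF that] ps[OF that] by (simp add: length_encode_nat)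
  define T where "T = 8 * length w + 7"
  have "wp parse (\<lambda>n r' m'. n \<le> length xs * (T + 2) + 9 \<and> r' rN = length w \<and> r' rOne = 1 \<and>
    m' = (\<lambda>i. if length w \<le> i \<and> i < length w + length xs then xs ! (i - length w) else m i)) r m"
    using assms(2) unfolding parse_def
    apply simp
    apply (rule wp_mono[OF wp_While[where k="length xs" and T=T and
       I="\<lambda>j r' m'. r' rPos = pos j \<and> r' rOut = length w + j \<and> r' rRem = length w - pos j \<and>
         m' = (\<lambda>i. if length w \<le> i \<and> i < length w + j then xs ! (i - length w) else m i)"]])
    subgoal for j r' m'
      using fin[of j]
      apply simp
      apply (rule wp_mono[OF wp_parse_nat[where v="xs ! j"]])
      subgoal by simp
      subgoal for i using pl[of j] wn[of j i] m[of "pos j + i"] ps[of j] by simp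
      subgoal for n r'' m''
        using ps[of j] pl[of j]
        by (auto simp: T_def length_encode_nat fun_eq_iff less_Suc_eq)
      done
    subgoal by (simp add: pe)
    subgoal by (simp add: p0 fun_eq_iff)
    subgoal by auto
    done
  moreover have "length xs * (T + 2) \<le> length w * (8 * length w + 9)"
    using lx by (intro mult_le_mono) (auto simp: T_def)
  ultimately show ?thesis
    by (elim wp_mono) auto
qed

definition setup_vars :: com where
  "setup_vars = Basic (Load rA rN) ;; Basic (Add rCB rN rOne) ;; Basic (Add rCB rCB rA) ;;
     Basic (Load rM rCB) ;; Basic (Add rCB rCB rOne) ;; Basic (Add rVB rCB rM) ;;
     Basic (Load rTau rVB) ;; Basic (Add rVB rVB rOne) ;; copy rKP rVB ;; Basic (Const rW 1) ;;
     copy rTC rTau ;;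
     While rTC (Basic (Add rKP rKP rA) ;; mul rW ;; mul rW ;; mul rW ;; Basic (Sub rTC rTC rOne)) ;;
     Basic (Load rK rKP) ;; Basic (Add rKP rKP rOne) ;; Basic (Load rL rKP) ;;
     Basic (Add rKP rKP rOne) ;; Basic (Load rX rKP)"

lemma wp_setup_vars:
  assumes "r rOne = 1" "r rN = N" "m N = a" "m (N + 1 + a) = c" "m (N + 2 + a + c) = \<tau>"
    "m (N + 3 + a + c + \<tau> * a) = k" "m (N + 4 + a + c + \<tau> * a) = l" "m (N + 5 + a + c + \<tau> * a) = x"
  shows "wp setup_vars (\<lambda>n r' m'. n \<le> \<tau> * (12 * N + 22) + 30 \<and> r' rOne = 1 \<and> r' rN = N \<and> r' rA = a \<and>
    r' rM = c \<and> r' rTau = \<tau> \<and> r' rCB = N + 2 + a \<and> r' rVB = N + 3 + a + c \<and> r' rK = k \<and>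
    r' rL = l \<and> r' rX = x \<and> r' rW = N ^ (3 * \<tau>) \<and> m' = m) r m"
  using assms unfolding setup_vars_def
  apply simp
  apply (rule wp_mono[OF wp_While[where k=\<tau> and T="12 * N + 20" and
     I="\<lambda>i r' m'. r' rTC = \<tau> - i \<and> r' rKP = N + 3 + a + c + i * a \<and> r' rW = N ^ (3 * i) \<and> m' = m"]])
  subgoal for i r' m'
    apply simp
    apply (rule wp_mono[OF wp_mul])
      apply simp
     apply simp
    apply simp
    apply (rule wp_mono[OF wp_mul])
      apply simp
     apply simp
    apply simp
    apply (rule wp_mono[OF wp_mul])
      apply simp
     apply simp
    apply (simp add: power_add power3_eq_cube)
    done
  subgoal by simp
  subgoal by simp
  subgoal by (simp add: algebra_simps)
  done

section \<open>Filling the table\<close>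

definition tally :: com where
  "tally = copy rAC rA ;;
     While rAC (Basic (Load rV rVP) ;; Basic (Add rVP rVP rOne) ;; Basic (Sub rY rV rCand) ;;
       Basic (Sub rV rCand rV) ;; Basic (Add rV rV rY) ;;
       If rV Skip (Basic (Add rG rG rWt)) ;; Basic (Sub rAC rAC rOne))"

lemma writes_tally [simp]: "writes tally = {rAC, rV, rVP, rY, rG}"
  by (auto simp: tally_def)

lemma card_less_Suc_Collect:
  "card {i. i < Suc k \<and> p i} = card {i. i < k \<and> p i} + of_bool (p k)"
proof -
  have "{i. i < Suc k \<and> p i} = (if p k then insert k {i. i < k \<and> p i} else {i. i < k \<and> p i})"
    by (auto simp: less_Suc_eq)
  then show ?thesis by simp
qed

lemma wp_tally:
  assumes "r rOne = 1"
  shows "wp tally (\<lambda>n r' m'. n \<le> 10 * r rA + 3 \<and> r' rVP = r rVP + r rA \<and>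
    r' rG = r rG + card {i. i < r rA \<and> m (r rVP + i) = r rCand} * r rWt \<and> m' = m) r m"
  using assms unfolding tally_def
  apply simp
  apply (rule wp_mono[OF wp_While[where k="r rA" and T=8 and
     I="\<lambda>i r' m'. r' rAC = r rA - i \<and> r' rVP = r rVP + i \<and>
       r' rG = r rG + card {j. j < i \<and> m (r rVP + j) = r rCand} * r rWt \<and> m' = m"]])
  subgoal for i r' m' by (auto simp: card_less_Suc_Collect algebra_simps)
  by auto

definition scan :: com where
  "scan = copy rSC rW ;;
     While rSC (Basic (Load rV rP) ;;
       If rV (Basic (Add rQ rP rE0) ;; Basic (Store rQ rOne) ;; Basic (Add rQ rP rE1) ;;
         Basic (Store rQ rOne)) Skip ;;
       Basic (Add rP rP rOne) ;; Basic (Sub rSC rSC rOne))"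

lemma writes_scan [simp]: "writes scan = {rSC, rV, rQ, rP}"
  by (auto simp: scan_def)

definition marks :: "(nat \<Rightarrow> nat) \<Rightarrow> nat \<Rightarrow> nat \<Rightarrow> nat \<Rightarrow> nat \<Rightarrow> nat \<Rightarrow> nat" where
  "marks m p k e0 e1 =
     (\<lambda>x. if \<exists>q. p \<le> q \<and> q < p + k \<and> m q \<noteq> 0 \<and> (x = q + e0 \<or> x = q + e1) then 1 else m x)"

lemma marks_Suc:
  assumes "k < e0" "k < e1"
  shows "marks m p (Suc k) e0 e1 = (if marks m p k e0 e1 (p + k) = 0 then marks m p k e0 e1
    else (marks m p k e0 e1)(p + k + e0 := 1, p + k + e1 := 1))"
proof -
  have *: "marks m p k e0 e1 (p + k) = m (p + k)"
    using assms by (auto simp: marks_def)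
  have "(\<exists>q. p \<le> q \<and> q < p + Suc k \<and> m q \<noteq> 0 \<and> (x = q + e0 \<or> x = q + e1)) \<longleftrightarrow>
      (\<exists>q. p \<le> q \<and> q < p + k \<and> m q \<noteq> 0 \<and> (x = q + e0 \<or> x = q + e1)) \<or>
      m (p + k) \<noteq> 0 \<and> (x = p + k + e0 \<or> x = p + k + e1)" for x
    by (metis add_Suc_right less_Suc_eq le_add1)
  then show ?thesis
    unfolding * by (simp add: marks_def fun_eq_iff)
qed

lemma wp_scan:
  assumes "r rOne = 1" "r rW \<le> r rE0" "r rW \<le> r rE1"
  shows "wp scan (\<lambda>n r' m'. n \<le> 11 * r rW + 3 \<and> r' rP = r rP + r rW \<and>
    m' = marks m (r rP) (r rW) (r rE0) (r rE1)) r m"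
  using assms unfolding scan_def
  apply simp
  apply (rule wp_mono[OF wp_While[where k="r rW" and T=9 and
     I="\<lambda>i r' m'. r' rSC = r rW - i \<and> r' rP = r rP + i \<and> m' = marks m (r rP) i (r rE0) (r rE1)"]])
  subgoal for i r' m'
    using marks_Suc[of i "r rE0" "r rE1" m "r rP"] by auto
  subgoal by simp
  subgoal by (auto simp: marks_def fun_eq_iff)
  subgoal by auto
  done

definition layer :: com where
  "layer = copy rG rWt ;; mul rWt ;; tally ;; mul rWt ;; copy rD rWt ;; mul rWt ;;
     Basic (Add rE0 rW rW) ;; Basic (Add rE1 rE0 rW) ;; Basic (Add rE1 rE1 rG) ;;
     Basic (Add rE1 rE1 rD) ;; scan ;;
     Basic (Add rE1 rE0 rG) ;; Basic (Add rE0 rW rD) ;; scan ;; Basic (Sub rTC rTC rOne)"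

lemma writes_layer [simp]: "writes layer =
    {rG, rWt, rY, rCnt, rAC, rV, rVP, rD, rE0, rE1, rSC, rQ, rP, rTC}"
  by (auto simp: layer_def)

text \<open>A cell \<open>u < 2 * w\<close> of a layer stands for the pair \<open>(b, s)\<close> with \<open>u = of_bool b * w + s\<close> and
  \<open>s < w\<close>, where \<open>b\<close> is the decision taken in the previous layer. Choosing a candidate adds \<open>g\<close>,
  deciding differently than in the previous layer adds \<open>d\<close>.\<close>

definition next_layer :: "nat \<Rightarrow> nat \<Rightarrow> nat \<Rightarrow> nat set \<Rightarrow> nat set" where
  "next_layer w g d L = (\<Union>u\<in>L. if u < w then {u, u + w + g + d} else {u - w + d, u + g})"

definition table :: "(nat \<Rightarrow> nat) \<Rightarrow> nat \<Rightarrow> nat set \<Rightarrow> bool" where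
  "table m p L \<longleftrightarrow> (\<forall>x. m (p + x) \<noteq> 0 \<longleftrightarrow> x \<in> L)"

lemma table_marks:
  fixes g d :: nat
  assumes "table m p L" "L \<subseteq> {..<2 * w}"
  defines "m' \<equiv> marks m p w (2 * w) (3 * w + g + d)"
  shows "table (marks m' (p + w) w (w + d) (2 * w + g)) (p + 2 * w) (next_layer w g d L)"
    (is "table ?m _ _")
proof -
  have T: "m q \<noteq> 0 \<longleftrightarrow> q - p \<in> L" if "p \<le> q" for q
    using assms(1) that unfolding table_def by (metis le_add_diff_inverse)
  have m'q: "m' q = m q" if "q < p + 2 * w" for q
    using that by (auto simp: m'_def marks_def)
  show ?thesis
    unfolding table_def
  proof
    fix x
    let ?y = "p + 2 * w + x"
    have 0: "m ?y = 0"
    proof -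
      have "2 * w + x \<notin> L" using assms(2) by auto
      then show ?thesis using T[of ?y] by (simp add: add.assoc)
    qed
    have "?m ?y \<noteq> 0 \<longleftrightarrow>
       (\<exists>q. p + w \<le> q \<and> q < p + w + w \<and> m' q \<noteq> 0 \<and> (?y = q + (w + d) \<or> ?y = q + (2 * w + g))) \<or> m' ?y \<noteq> 0"
      by (auto simp: marks_def[of m'])
    also have "\<dots> \<longleftrightarrow>
       (\<exists>q. p + w \<le> q \<and> q < p + w + w \<and> m q \<noteq> 0 \<and> (?y = q + (w + d) \<or> ?y = q + (2 * w + g))) \<or>
       (\<exists>q. p \<le> q \<and> q < p + w \<and> m q \<noteq> 0 \<and> (?y = q + 2 * w \<or> ?y = q + (3 * w + g + d)))"
      using m'q 0 by (auto simp: m'_def marks_def[of m p])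
    also have "\<dots> \<longleftrightarrow>
       (\<exists>u. w \<le> u \<and> u < 2 * w \<and> u \<in> L \<and> (x = u - w + d \<or> x = u + g)) \<or>
       (\<exists>u. u < w \<and> u \<in> L \<and> (x = u \<or> x = u + w + g + d))"
    proof (intro arg_cong2[where f="(\<or>)"] iffI; elim exE conjE)
      fix q assume "p + w \<le> q" "q < p + w + w" "m q \<noteq> 0" "?y = q + (w + d) \<or> ?y = q + (2 * w + g)"
      then show "\<exists>u. w \<le> u \<and> u < 2 * w \<and> u \<in> L \<and> (x = u - w + d \<or> x = u + g)"
        using T[of q] by (intro exI[of _ "q - p"]) auto
    next
      fix u assume "w \<le> u" "u < 2 * w" "u \<in> L" "x = u - w + d \<or> x = u + g"
      then show "\<exists>q. p + w \<le> q \<and> q < p + w + w \<and> m q \<noteq> 0 \<and> (?y = q + (w + d) \<or> ?y = q + (2 * w + g))"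
        using T[of "p + u"] by (intro exI[of _ "p + u"]) auto
    next
      fix q assume "p \<le> q" "q < p + w" "m q \<noteq> 0" "?y = q + 2 * w \<or> ?y = q + (3 * w + g + d)"
      then show "\<exists>u. u < w \<and> u \<in> L \<and> (x = u \<or> x = u + w + g + d)"
        using T[of q] by (intro exI[of _ "q - p"]) auto
    next
      fix u assume "u < w" "u \<in> L" "x = u \<or> x = u + w + g + d"
      then show "\<exists>q. p \<le> q \<and> q < p + w \<and> m q \<noteq> 0 \<and> (?y = q + 2 * w \<or> ?y = q + (3 * w + g + d))"
        using T[of "p + u"] by (intro exI[of _ "p + u"]) auto
    qed
    also have "\<dots> \<longleftrightarrow> x \<in> next_layer w g d L"
      using assms(2) unfolding next_layer_def UN_iff Bex_def lessThan_iff subset_iff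
      by (smt (verit) empty_iff insert_iff not_less)
    finally show "?m ?y \<noteq> 0 \<longleftrightarrow> x \<in> next_layer w g d L" .
  qed
qed

lemma marks_below: "x < p \<Longrightarrow> marks m p k e0 e1 x = m x"
  by (auto simp: marks_def)

lemma wp_layer:
  assumes "r rOne = 1" "r rN = N" "r rW = w" "table m (r rP) L" "L \<subseteq> {..<2 * w}"
    and "r rWt = N ^ (3 * t)"
    and "g = N ^ (3 * t) + card {i. i < r rA \<and> m (r rVP + i) = r rCand} * N ^ (3 * t + 1)"
    and "d = N ^ (3 * t + 2)"
  shows "wp layer (\<lambda>n r' m'. n \<le> 12 * N + 10 * r rA + 22 * w + 40 \<and>
    r' rVP = r rVP + r rA \<and> r' rTC = r rTC - 1 \<and> r' rWt = N ^ (3 * Suc t) \<and>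
    r' rP = r rP + 2 * w \<and> table m' (r' rP) (next_layer w g d L) \<and> (\<forall>x < r rP. m' x = m x)) r m"
proof -
  have g: "g = N ^ (3 * t) + card {i. i < r rA \<and> m (r rVP + i) = r rCand} * (N ^ (3 * t) * N)"
    and d: "d = N ^ (3 * t) * N * N"
    using assms(7,8) by (auto simp: power_add power2_eq_square)
  have triple: "3 * w = w + w + w" by simp
  have t: "table (marks (marks m (r rP) w (w + w) (w + w + w + g + d)) (r rP + w) w (w + d) (w + w + g))
      (r rP + w + w) (next_layer w g d L)"
    using table_marks[OF assms(4,5), of g d]
    unfolding mult_2 triple add.assoc by (simp only: add_ac)
  show ?thesis
    using assms(1-3,6) unfolding layer_def
    apply simp
    apply (rule wp_mono[OF wp_mul])
      apply simp
     apply simp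
    apply simp
    apply (rule wp_mono[OF wp_tally])
     apply simp
    apply simp
    apply (rule wp_mono[OF wp_mul])
      apply simp
     apply simp
    apply simp
    apply (rule wp_mono[OF wp_mul])
      apply simp
     apply simp
    apply simp
    apply (rule wp_mono[OF wp_scan])
       apply simp
      apply simp
     apply simp
    apply simp
    apply (rule wp_mono[OF wp_scan])
       apply simp
      apply simp
     apply simp
    apply simp
    using t[unfolded g d]
    by (simp add: g d marks_below power_add power3_eq_cube add_ac)
qed

fun layers :: "nat \<Rightarrow> (nat \<Rightarrow> nat) \<Rightarrow> (nat \<Rightarrow> nat) \<Rightarrow> nat \<Rightarrow> nat set" where
  "layers w g d 0 = {0}"
| "layers w g d (Suc j) = next_layer w (g j) (d j) (layers w g d j)"

definition column :: com where
  "column = Basic (Load rCand rCP) ;; Basic (Add rCand rCand rOne) ;; copy rVP rVB ;;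
     Basic (Const rWt 1) ;; copy rTC rTau ;; While rTC layer ;;
     Basic (Add rCP rCP rOne) ;; Basic (Sub rCC rCC rOne)"

lemma writes_column [simp]: "writes column =
    {rCand, rCP, rCC, rG, rWt, rY, rCnt, rAC, rV, rVP, rD, rE0, rE1, rSC, rQ, rP, rTC}"
  by (auto simp: column_def)

lemma wp_column:
  assumes r: "r rOne = 1" "r rN = N" "r rW = w" "r rA = a" "r rTau = \<tau>"
    and tab: "table m (r rP) (layers w g d j)"
    and bounded: "\<And>t. t < \<tau> \<Longrightarrow> layers w g d (j + t) \<subseteq> {..<2 * w}"
    and addr: "r rVB + \<tau> * a \<le> r rP"
    and g: "\<And>t. t < \<tau> \<Longrightarrow> g (j + t) = N ^ (3 * t) +
      card {i. i < a \<and> m (r rVB + t * a + i) = Suc (m (r rCP))} * N ^ (3 * t + 1)"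
    and d: "\<And>t. t < \<tau> \<Longrightarrow> d (j + t) = N ^ (3 * t + 2)"
  shows "wp column (\<lambda>n r' m'. n \<le> \<tau> * (12 * N + 10 * a + 22 * w + 42) + 10 \<and>
    r' rCP = r rCP + 1 \<and> r' rCC = r rCC - 1 \<and> r' rP = r rP + \<tau> * (2 * w) \<and>
    table m' (r' rP) (layers w g d (j + \<tau>)) \<and> (\<forall>x < r rP. m' x = m x)) r m"
proof -
  define I where "I t r' m' \<longleftrightarrow> r' rTC = \<tau> - t \<and> r' rVP = r rVB + t * a \<and> r' rWt = N ^ (3 * t) \<and>
       r' rP = r rP + t * (2 * w) \<and> table m' (r' rP) (layers w g d (j + t)) \<and>
       (\<forall>x < r rP. m' x = m x)" for t and r' m' :: "nat \<Rightarrow> nat"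
  let ?T = "12 * N + 10 * a + 22 * w + 40"
  have body: "r' rTC \<noteq> 0 \<and> wp layer (\<lambda>n r'' m''. n \<le> ?T \<and> I (Suc t) r'' m'') r' m'"
    if "t < \<tau>" "I t r' m'"
      and r': "r' rOne = 1" "r' rN = N" "r' rW = w" "r' rA = a" "r' rCand = Suc (m (r rCP))"
    for t r' m'
  proof -
    have I: "r' rTC = \<tau> - t" "r' rVP = r rVB + t * a" "r' rWt = N ^ (3 * t)"
      "r' rP = r rP + t * (2 * w)" "table m' (r' rP) (layers w g d (j + t))"
      "\<And>x. x < r rP \<Longrightarrow> m' x = m x"
      using that(2) by (auto simp: I_def)
    have "m' (r rVB + t * a + i) = m (r rVB + t * a + i)" if "i < a" for i
    proof -
      have "(t + 1) * a \<le> \<tau> * a" using \<open>t < \<tau>\<close> by (intro mult_le_mono1) simp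
      then show ?thesis using addr that by (intro I(6)) (simp add: algebra_simps)
    qed
    then have g': "g (j + t) = N ^ (3 * t) +
      card {i. i < r' rA \<and> m' (r' rVP + i) = r' rCand} * N ^ (3 * t + 1)"
      using g[OF \<open>t < \<tau>\<close>] I r' by (auto intro!: arg_cong[where f=card])
    have "wp layer (\<lambda>n r'' m''. n \<le> ?T \<and> I (Suc t) r'' m'') r' m'"
      using wp_layer[OF r'(1-3) I(5) bounded[OF \<open>t < \<tau>\<close>] I(3) g' d[OF \<open>t < \<tau>\<close>]]
      by (rule wp_mono) (use I r' in \<open>auto simp: I_def\<close>)
    then show ?thesis using I(1) \<open>t < \<tau>\<close> by simp
  qed
  show ?thesis
    using r unfolding column_def
    apply simp
    apply (rule wp_mono[OF wp_While[where k=\<tau> and T="?T" and I=I]])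
    subgoal by (rule body) simp_all
    subgoal by (simp add: I_def)
    subgoal using tab by (simp add: I_def)
    subgoal by (auto simp: I_def algebra_simps)
    done
qed

definition dp :: com where
  "dp = Basic (Add rP rN rN) ;; Basic (Store rP rOne) ;; copy rCP rCB ;; copy rCC rM ;; While rCC column"

lemma writes_dp [simp]: "writes dp =
    {rCand, rCP, rCC, rG, rWt, rY, rCnt, rAC, rV, rVP, rD, rE0, rE1, rSC, rQ, rP, rTC}"
  by (auto simp: dp_def)

lemma wp_dp:
  assumes r: "r rOne = 1" "r rN = N" "r rW = w" "r rA = a" "r rTau = \<tau>" "r rM = c"
    and empty: "\<And>x. 2 * N \<le> x \<Longrightarrow> m x = 0"
    and bounded: "\<And>j. j < c * \<tau> \<Longrightarrow> layers w g d j \<subseteq> {..<2 * w}"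
    and addr: "r rVB + \<tau> * a \<le> 2 * N" "r rCB + c \<le> 2 * N"
    and g: "\<And>j t. j < c \<Longrightarrow> t < \<tau> \<Longrightarrow> g (j * \<tau> + t) = N ^ (3 * t) +
      card {i. i < a \<and> m (r rVB + t * a + i) = Suc (m (r rCB + j))} * N ^ (3 * t + 1)"
    and d: "\<And>j t. j < c \<Longrightarrow> t < \<tau> \<Longrightarrow> d (j * \<tau> + t) = N ^ (3 * t + 2)"
  shows "wp dp (\<lambda>n r' m'. n \<le> c * (\<tau> * (12 * N + 10 * a + 22 * w + 42) + 12) + 7 \<and>
    table m' (r' rP) (layers w g d (c * \<tau>))) r m"
proof -
  define I where "I j r' m' \<longleftrightarrow> r' rCC = c - j \<and> r' rCP = r rCB + j \<and>
       r' rP = 2 * N + j * (\<tau> * (2 * w)) \<and> table m' (r' rP) (layers w g d (j * \<tau>)) \<and>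
       (\<forall>x < 2 * N. m' x = m x)" for j and r' m' :: "nat \<Rightarrow> nat"
  let ?T = "\<tau> * (12 * N + 10 * a + 22 * w + 42) + 10"
  have body: "r' rCC \<noteq> 0 \<and> wp column (\<lambda>n r'' m''. n \<le> ?T \<and> I (Suc j) r'' m'') r' m'"
    if "j < c" "I j r' m'"
      and r': "r' rOne = 1" "r' rN = N" "r' rW = w" "r' rA = a" "r' rTau = \<tau>" "r' rVB = r rVB"
    for j r' m'
  proof -
    have I: "r' rCC = c - j" "r' rCP = r rCB + j"
      "r' rP = 2 * N + j * (\<tau> * (2 * w))" "table m' (r' rP) (layers w g d (j * \<tau>))"
      "\<And>x. x < 2 * N \<Longrightarrow> m' x = m x"
      using that(2) by (auto simp: I_def)
    have jt: "j * \<tau> + t < c * \<tau>" if "t < \<tau>" for t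
    proof -
      have "(j + 1) * \<tau> \<le> c * \<tau>" using \<open>j < c\<close> by (intro mult_le_mono1) simp
      then show ?thesis using that by simp
    qed
    have m1: "m' (r rVB + t * a + i) = m (r rVB + t * a + i)" if "i < a" "t < \<tau>" for i t
    proof -
      have "(t + 1) * a \<le> \<tau> * a" using \<open>t < \<tau>\<close> by (intro mult_le_mono1) simp
      then show ?thesis using addr that by (intro I(5)) (simp add: algebra_simps)
    qed
    have m2: "m' (r rCB + j) = m (r rCB + j)"
      using addr \<open>j < c\<close> by (intro I(5)) simp
    have g': "g (j * \<tau> + t) = N ^ (3 * t) +
      card {i. i < a \<and> m' (r' rVB + t * a + i) = Suc (m' (r' rCP))} * N ^ (3 * t + 1)" if "t < \<tau>" for t
      unfolding g[OF \<open>j < c\<close> that] using I r' m1[OF _ that] m2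
      by (auto intro!: arg_cong[where f=card])
    have addr': "r' rVB + \<tau> * a \<le> r' rP" using addr I r' by simp
    have "wp column (\<lambda>n r'' m''. n \<le> ?T \<and> I (Suc j) r'' m'') r' m'"
      using wp_column[OF r'(1-5) I(4) bounded[OF jt] addr' g' d[OF \<open>j < c\<close>]]
      by (rule wp_mono) (use I r' in \<open>auto simp: I_def algebra_simps\<close>)
    then show ?thesis using I(1) \<open>j < c\<close> by simp
  qed
  show ?thesis
    using r unfolding dp_def
    apply simp
    apply (rule wp_mono[OF wp_While[where k=c and T="?T" and I=I]])
    subgoal by (rule body) simp_all
    subgoal by (simp add: I_def)
    subgoal using empty by (simp add: I_def table_def)
    subgoal by (auto simp: I_def algebra_simps)
    done
qed

section \<open>Testing the digits\<close>

definition div_mod :: com where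
  "div_mod = Basic (Const rY 0) ;; Basic (Add rCnt rXX rOne) ;; Basic (Sub rCnt rCnt rN) ;;
     While rCnt (Basic (Sub rXX rXX rN) ;; Basic (Add rY rY rOne) ;;
       Basic (Add rCnt rXX rOne) ;; Basic (Sub rCnt rCnt rN)) ;;
     copy rRes rXX ;; copy rXX rY"

lemma writes_div_mod [simp]: "writes div_mod = {rY, rCnt, rXX, rRes}"
  by (auto simp: div_mod_def)

lemma wp_div_mod:
  assumes "r rOne = 1" "0 < r rN"
  shows "wp div_mod (\<lambda>n r' m'. n \<le> 6 * r rXX + 8 \<and> r' rXX = r rXX div r rN \<and>
    r' rRes = r rXX mod r rN \<and> m' = m) r m"
proof -
  let ?N = "r rN" and ?x = "r rXX"
  have less: "i * ?N + ?N \<le> ?x" if "i < ?x div ?N" for i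
  proof -
    have "(i + 1) * ?N \<le> ?x div ?N * ?N" using that by (intro mult_le_mono1) simp
    also have "\<dots> \<le> ?x" by simp
    finally show ?thesis by simp
  qed
  have div_le: "?x div ?N \<le> ?x" by simp
  show ?thesis
    using assms unfolding div_mod_def
    apply simp
    apply (rule wp_mono[OF wp_While[where k="?x div ?N" and T=4 and
      I="\<lambda>i r' m'. r' rXX = ?x - i * ?N \<and> r' rY = i \<and> r' rCnt = Suc (?x - i * ?N) - ?N \<and> m' = m"]])
    subgoal for i r' m' using less[of i] by auto
    subgoal for r' m'
      using mod_less_divisor[OF assms(2), of ?x] by (simp add: minus_div_mult_eq_mod)
    subgoal by simp
    subgoal using div_le by (auto simp: minus_div_mult_eq_mod simp del: div_le_dividend)
    done
qed

abbreviation digit :: "nat \<Rightarrow> nat \<Rightarrow> nat \<Rightarrow> nat" where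
  "digit N v i \<equiv> v div N ^ i mod N"

definition check_le :: "nat \<Rightarrow> nat \<Rightarrow> nat \<Rightarrow> com" where
  "check_le f s t = div_mod ;; Basic (Sub rY s t) ;; If f (If rY (Basic (Const rOk 0)) Skip) Skip"

lemma writes_check_le [simp]: "writes (check_le f s t) = {rY, rCnt, rXX, rRes, rOk}"
  by (auto simp: check_le_def)

lemma wp_check_le:
  assumes "r rOne = 1" "0 < r rN" "f \<notin> {rY, rCnt, rXX, rRes}" "s \<notin> {rY, rCnt, rXX}" "t \<notin> {rY, rCnt, rXX}"
  defines "r1 \<equiv> r(rRes := r rXX mod r rN)"
  shows "wp (check_le f s t) (\<lambda>n r' m'. n \<le> 6 * r rXX + 14 \<and> r' rXX = r rXX div r rN \<and> m' = m \<and>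
    r' rOk = (if r f \<noteq> 0 \<and> r1 t < r1 s then 0 else r rOk)) r m"
  using assms(1-5) unfolding check_le_def
  apply (simp split del: if_split)
  apply (rule wp_mono[OF wp_div_mod])
    apply simp
   apply simp
  apply (auto simp: r1_def)
  done

definition check_digits :: "bool \<Rightarrow> com" where
  "check_digits conservative =
     check_le rOne rRes rK ;; check_le rOne rX rRes ;;
     (if conservative then check_le rF rRes rL else check_le rF rL rRes) ;;
     copy rF rOne ;; Basic (Sub rTC rTC rOne)"

lemma writes_check_digits [simp]:
  "writes (check_digits b) = {rY, rCnt, rXX, rRes, rOk, rF, rTC}"
  by (auto simp: check_digits_def)

definition digits_ok :: "bool \<Rightarrow> nat \<Rightarrow> nat \<Rightarrow> nat \<Rightarrow> nat \<Rightarrow> nat \<Rightarrow> nat \<Rightarrow> bool" where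
  "digits_ok conservative N k l x v t \<longleftrightarrow>
     digit N v (3 * t) \<le> k \<and> x \<le> digit N v (3 * t + 1) \<and>
     (0 < t \<longrightarrow> (if conservative then digit N v (3 * t + 2) \<le> l else l \<le> digit N v (3 * t + 2)))"

lemma wp_check_digits:
  assumes "r rOne = 1" "r rN = N" "0 < N" "r rXX = v div N ^ (3 * t)"
    "r rF = of_bool (0 < t)" "r rK = k" "r rL = l" "r rX = x"
  shows "wp (check_digits b) (\<lambda>n r' m'. n \<le> 18 * v + 50 \<and> r' rXX = v div N ^ (3 * Suc t) \<and>
    r' rF = 1 \<and> r' rTC = r rTC - 1 \<and> m' = m \<and>
    r' rOk = (if digits_ok b N k l x v t then r rOk else 0)) r m"
proof -
  define y0 y1 y2 where "y0 = v div N ^ (3 * t)" and "y1 = v div N ^ (3 * t + 1)"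
    and "y2 = v div N ^ (3 * t + 2)"
  define y3 where "y3 = v div N ^ (3 * Suc t)"
  have y: "y0 div N = y1" "y1 div N = y2" "y2 div N = y3"
    unfolding y0_def y1_def y2_def y3_def
    by (simp_all add: div_mult2_eq[symmetric] power_add power3_eq_cube power2_eq_square mult_ac)
  have le: "y0 \<le> v" "y1 \<le> v" "y2 \<le> v"
    by (simp_all add: y0_def y1_def y2_def)
  have ok: "digits_ok b N k l x v t \<longleftrightarrow> y0 mod N \<le> k \<and> x \<le> y1 mod N \<and>
      (0 < t \<longrightarrow> (if b then y2 mod N \<le> l else l \<le> y2 mod N))"
    by (simp add: digits_ok_def y0_def y1_def y2_def)
  show ?thesis
    using assms unfolding check_digits_def ok y0_def[symmetric] y3_def[symmetric]
    apply (simp only: wp_Seq)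
    apply (rule wp_mono[OF wp_check_le])
         apply simp_all[5]
    apply (simp only: wp_Seq)
    apply (rule wp_mono[OF wp_check_le])
         apply simp_all[5]
    apply (simp only: wp_Seq)
    apply (cases b)
     apply (simp_all only: if_True if_False)
     apply (rule wp_mono[OF wp_check_le])
          apply simp_all[5]
     apply (use le in \<open>auto simp: y\<close>)[1]
    apply (rule wp_mono[OF wp_check_le])
         apply simp_all[5]
    apply (use le in \<open>auto simp: y\<close>)[1]
    done
qed

definition check_state :: "bool \<Rightarrow> com" where
  "check_state b = copy rXX rS ;; Basic (Const rOk 1) ;; Basic (Const rF 0) ;; copy rTC rTau ;;
     While rTC (check_digits b) ;; If rOk (Basic (Const rAns 1)) Skip"

lemma writes_check_state [simp]:
  "writes (check_state b) = {rY, rCnt, rXX, rRes, rOk, rF, rTC, rAns}"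
  by (auto simp: check_state_def)

lemma wp_check_state:
  assumes "r rOne = 1" "r rN = N" "0 < N" "r rTau = \<tau>" "r rK = k" "r rL = l" "r rX = x"
  shows "wp (check_state b) (\<lambda>n r' m'. n \<le> \<tau> * (18 * r rS + 52) + 10 \<and> m' = m \<and>
    r' rAns = (if \<forall>t < \<tau>. digits_ok b N k l x (r rS) t then 1 else r rAns)) r m"
proof -
  define I where "I t r' m' \<longleftrightarrow> r' rTC = \<tau> - t \<and> r' rXX = r rS div N ^ (3 * t) \<and>
      r' rF = of_bool (0 < t) \<and> m' = m \<and>
      r' rOk = of_bool (\<forall>i < t. digits_ok b N k l x (r rS) i)" for t and r' m' :: "nat \<Rightarrow> nat"
  let ?T = "18 * r rS + 50"
  have body: "r' rTC \<noteq> 0 \<and> wp (check_digits b) (\<lambda>n r'' m''. n \<le> ?T \<and> I (Suc t) r'' m'') r' m'"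
    if "t < \<tau>" "I t r' m'" and r': "r' rOne = 1" "r' rN = N" "r' rK = k" "r' rL = l" "r' rX = x"
    for t r' m'
  proof -
    have I: "r' rTC = \<tau> - t" "r' rXX = r rS div N ^ (3 * t)"
      "r' rF = of_bool (0 < t)" "m' = m" "r' rOk = of_bool (\<forall>i < t. digits_ok b N k l x (r rS) i)"
      using that(2) by (auto simp: I_def)
    have "wp (check_digits b) (\<lambda>n r'' m''. n \<le> ?T \<and> I (Suc t) r'' m'') r' m'"
      using wp_check_digits[OF r'(1,2) \<open>0 < N\<close> I(2,3) r'(3-5)]
      by (rule wp_mono) (use I in \<open>auto simp: I_def less_Suc_eq\<close>)
    then show ?thesis using I(1) \<open>t < \<tau>\<close> by simp
  qed
  show ?thesis
    using assms unfolding check_state_def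
    apply (simp split del: if_split)
    apply (rule wp_mono[OF wp_While[where k=\<tau> and T="?T" and I=I]])
    subgoal by (rule body) simp_all
    subgoal by (simp add: I_def)
    subgoal by (simp add: I_def)
    subgoal by (auto simp: I_def algebra_simps)
    done
qed

definition final :: "bool \<Rightarrow> com" where
  "final b = Basic (Const rS 0) ;; Basic (Const rAns 0) ;; Basic (Add rSC rW rW) ;;
     While rSC (Basic (Load rV rP) ;; If rV (check_state b) Skip ;; Basic (Add rP rP rOne) ;;
       Basic (Add rS rS rOne) ;; Basic (Sub rSC rSC rOne)) ;;
     copy 0 rAns"

lemma wp_final:
  assumes "r rOne = 1" "r rN = N" "0 < N" "r rTau = \<tau>" "r rK = k" "r rL = l" "r rX = x" "r rW = w"
    and "table m (r rP) L"
  shows "wp (final b) (\<lambda>n r' m'. n \<le> 2 * w * (\<tau> * (36 * w + 52) + 20) + 6 \<and>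
    (r' 0 \<noteq> 0 \<longleftrightarrow> (\<exists>v \<in> L. v < 2 * w \<and> (\<forall>t < \<tau>. digits_ok b N k l x v t)))) r m"
proof -
  let ?ok = "\<lambda>v. \<forall>t < \<tau>. digits_ok b N k l x v t"
  define I where "I i r' m' \<longleftrightarrow> r' rSC = 2 * w - i \<and> r' rP = r rP + i \<and> r' rS = i \<and> m' = m \<and>
      r' rAns = of_bool (\<exists>v \<in> L. v < i \<and> ?ok v)" for i and r' m' :: "nat \<Rightarrow> nat"
  have tab: "m (r rP + i) \<noteq> 0 \<longleftrightarrow> i \<in> L" for i
    using assms(9) by (simp add: table_def)
  let ?T = "\<tau> * (36 * w + 52) + 18"
  let ?c = "Basic (Load rV rP) ;; If rV (check_state b) Skip ;; Basic (Add rP rP rOne) ;;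
       Basic (Add rS rS rOne) ;; Basic (Sub rSC rSC rOne)"
  have body: "r' rSC \<noteq> 0 \<and> wp ?c (\<lambda>n r'' m''. n \<le> ?T \<and> I (Suc i) r'' m'') r' m'"
    if "i < 2 * w" "I i r' m'" and r': "r' rOne = 1" "r' rN = N" "r' rTau = \<tau>" "r' rK = k"
      "r' rL = l" "r' rX = x"
    for i r' m'
  proof -
    have I: "r' rSC = 2 * w - i" "r' rP = r rP + i" "r' rS = i" "m' = m"
      "r' rAns = of_bool (\<exists>v \<in> L. v < i \<and> ?ok v)"
      using that(2) by (auto simp: I_def)
    have step: "(\<exists>v \<in> L. v < Suc i \<and> ?ok v) \<longleftrightarrow> (\<exists>v \<in> L. v < i \<and> ?ok v) \<or> i \<in> L \<and> ?ok i"
      by (auto simp: less_Suc_eq)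
    have time: "\<tau> * (18 * i + 52) \<le> \<tau> * (36 * w + 52)"
      using \<open>i < 2 * w\<close> by (intro mult_le_mono2) simp
    then have time': "n \<le> \<tau> * (18 * i + 52) + 10 \<Longrightarrow> n \<le> \<tau> * (36 * w + 52) + 10" for n
      by linarith
    have "wp ?c (\<lambda>n r'' m''. n \<le> ?T \<and> I (Suc i) r'' m'') r' m'"
    proof (cases "i \<in> L")
      case True
      then have [simp]: "0 < m (r rP + i)" using tab[of i] by simp
      let ?r = "r'(rV := m (r rP + i))"
      have "wp (check_state b) (\<lambda>n r'' m''. n \<le> \<tau> * (18 * ?r rS + 52) + 10 \<and> m'' = m \<and>
          r'' rAns = (if ?ok (?r rS) then 1 else ?r rAns)) ?r m"
        by (rule wp_check_state) (use assms r' in simp_all)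
      then have "wp (check_state b) (\<lambda>n r'' m''. n \<le> \<tau> * (36 * w + 52) + 10 \<and> m'' = m \<and>
          r'' rAns = of_bool (\<exists>v \<in> L. v < Suc i \<and> ?ok v) \<and> r'' rSC = 2 * w - i \<and>
          r'' rP = r rP + i \<and> r'' rS = i \<and> r'' rOne = 1) ?r m"
        by (rule wp_mono) (cases "?ok i"; use I r' True time' in \<open>simp add: step\<close>)
      then show ?thesis
        using I by simp (erule wp_mono, simp add: I_def)
    next
      case False
      then have [simp]: "m (r rP + i) = 0" using tab[of i] by simp
      show ?thesis
        using I r' False unfolding I_def step by simp
    qed
    then show ?thesis using I(1) \<open>i < 2 * w\<close> by simp
  qed
  show ?thesis
    using assms(1-8) unfolding final_def
    apply (simp del: wp_If)
    apply (rule wp_mono[OF wp_While[where k="2 * w" and T="?T" and I=I]])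
    subgoal by (rule body) simp_all
    subgoal by (simp add: I_def)
    subgoal by (simp add: I_def)
    subgoal by (auto simp: I_def algebra_simps)
    done
qed

section \<open>Digits of the reachable numbers\<close>

text \<open>\<open>f (Suc i)\<close> is the decision taken in layer \<open>i\<close>; \<open>f 0\<close> is a dummy predecessor of the first one.\<close>

definition path_sum :: "(nat \<Rightarrow> nat) \<Rightarrow> (nat \<Rightarrow> nat) \<Rightarrow> (nat \<Rightarrow> bool) \<Rightarrow> nat \<Rightarrow> nat" where
  "path_sum g d f j = (\<Sum>i<j. of_bool (f (Suc i)) * g i + of_bool (f (Suc i) \<noteq> f i) * d i)"

lemma path_sum_mono: "i \<le> j \<Longrightarrow> path_sum g d f i \<le> path_sum g d f j"
  unfolding path_sum_def by (rule sum_mono2) auto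

lemma layers_eq:
  assumes "\<And>f i. i < j \<Longrightarrow> path_sum g d f i < w"
  shows "layers w g d j = {of_bool (f j) * w + path_sum g d f j | f. \<not> f 0}"
  using assms
proof (induction j)
  case 0
  have "\<exists>f. \<not> f (0 :: nat)" by (rule exI[of _ "\<lambda>_. False"]) simp
  then show ?case by (auto simp: path_sum_def)
next
  case (Suc j)
  have IH: "layers w g d j = {of_bool (f j) * w + path_sum g d f j | f. \<not> f 0}"
    using Suc by simp
  have bd: "path_sum g d f j < w" for f using Suc.prems by simp
  have ps: "path_sum g d f (Suc j) = path_sum g d f j + of_bool (f (Suc j)) * g j +
      of_bool (f (Suc j) \<noteq> f j) * d j" for f
    by (simp add: path_sum_def)
  let ?S = "\<lambda>u. if u < w then {u, u + w + g j + d j} else {u - w + d j, u + g j}"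
  have S: "?S (of_bool (f j) * w + path_sum g d f j) =
     (\<lambda>b. of_bool b * w + path_sum g d f j + of_bool b * g j + of_bool (b \<noteq> f j) * d j) ` UNIV" for f
  proof (cases "f j")
    case True
    then show ?thesis using bd[of f] unfolding UNIV_bool by simp
  next
    case False
    then show ?thesis using bd[of f] unfolding UNIV_bool by (simp add: add_ac)
  qed
  show ?case
  proof (intro set_eqI iffI)
    fix v assume "v \<in> layers w g d (Suc j)"
    then obtain f b where f: "\<not> f 0"
      "v = of_bool b * w + path_sum g d f j + of_bool b * g j + of_bool (b \<noteq> f j) * d j"
      unfolding layers.simps next_layer_def IH using S by (smt (verit) UN_E imageE mem_Collect_eq)
    have "path_sum g d (f(Suc j := b)) j = path_sum g d f j"
      unfolding path_sum_def by (rule sum.cong) auto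
    then have "v = of_bool ((f(Suc j := b)) (Suc j)) * w + path_sum g d (f(Suc j := b)) (Suc j)"
      using f by (simp add: ps)
    then show "v \<in> {of_bool (f (Suc j)) * w + path_sum g d f (Suc j) | f. \<not> f 0}"
      using f(1) by (intro CollectI exI[of _ "f(Suc j := b)"]) simp
  next
    fix v assume "v \<in> {of_bool (f (Suc j)) * w + path_sum g d f (Suc j) | f. \<not> f 0}"
    then obtain f where f: "\<not> f 0" "v = of_bool (f (Suc j)) * w + path_sum g d f (Suc j)" by blast
    have "of_bool b * w + path_sum g d f j + of_bool b * g j + of_bool (b \<noteq> f j) * d j
        \<in> ?S (of_bool (f j) * w + path_sum g d f j)" for b
      unfolding S[of f] by (rule rangeI)
    from this[of "f (Suc j)"] have "v \<in> ?S (of_bool (f j) * w + path_sum g d f j)"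
      unfolding f(2) ps by (simp only: add.assoc)
    moreover have "of_bool (f j) * w + path_sum g d f j \<in> layers w g d j"
      unfolding IH using f(1) by (intro CollectI exI[of _ f] conjI refl)
    ultimately show "v \<in> layers w g d (Suc j)" unfolding layers.simps next_layer_def by (rule UN_I[rotated])
  qed
qed

lemma sum_digits_less:
  assumes "\<And>i. i < k \<Longrightarrow> e i < (N :: nat)"
  shows "(\<Sum>i<k. e i * N ^ i) < N ^ k"
  using assms
proof (induction k)
  case (Suc k)
  have "(\<Sum>i<Suc k. e i * N ^ i) < N ^ k + e k * N ^ k" using Suc by simp
  also have "\<dots> = Suc (e k) * N ^ k" by simp
  also have "\<dots> \<le> N * N ^ k" using Suc.prems[of k] by (intro mult_le_mono1) simp
  finally show ?case by simp
qed simp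

lemma digit_sum:
  assumes "\<And>i. i < k \<Longrightarrow> e i < (N :: nat)" "j < k"
  shows "digit N (z * N ^ k + (\<Sum>i<k. e i * N ^ i)) j = e j"
proof -
  have "\<exists>z'. z * N ^ k + (\<Sum>i<k. e i * N ^ i) = (\<Sum>i<j. e i * N ^ i) + N ^ j * (e j + N * z')"
    using assms(2)
  proof (induction k arbitrary: z)
    case (Suc k)
    show ?case
    proof (cases "j = k")
      case True
      then show ?thesis by (intro exI[of _ z]) (simp add: algebra_simps)
    next
      case False
      then have "\<exists>z'. (z * N + e k) * N ^ k + (\<Sum>i<k. e i * N ^ i) =
          (\<Sum>i<j. e i * N ^ i) + N ^ j * (e j + N * z')"
        using Suc by simp
      then show ?thesis by (simp add: algebra_simps)
    qed
  qed simp
  then obtain z' where z': "z * N ^ k + (\<Sum>i<k. e i * N ^ i) =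
      (\<Sum>i<j. e i * N ^ i) + N ^ j * (e j + N * z')" by blast
  have less: "(\<Sum>i<j. e i * N ^ i) < N ^ j"
    using assms by (intro sum_digits_less) simp
  then have "N ^ j \<noteq> 0" by linarith
  then have "((\<Sum>i<j. e i * N ^ i) + N ^ j * (e j + N * z')) div N ^ j = e j + N * z'"
    using less by simp
  then show ?thesis
    unfolding z' using assms by simp
qed

lemma sum_rows: "(\<Sum>i<c * \<tau>. h i) = (\<Sum>t<\<tau>. \<Sum>j<c. h (j * \<tau> + t :: nat))"
  for h :: "nat \<Rightarrow> nat"
proof -
  have "(\<Sum>i<c * \<tau>. h i) = (\<Sum>j<c. \<Sum>t<\<tau>. h (j * \<tau> + t))"
  proof (induction c)
    case (Suc c)
    have "(\<Sum>i<Suc c * \<tau>. h i) = (\<Sum>i<c * \<tau>. h i) + sum h {c * \<tau>..<c * \<tau> + \<tau>}"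
      unfolding lessThan_atLeast0
      using sum.atLeastLessThan_concat[of 0 "c * \<tau>" "c * \<tau> + \<tau>" h] by (simp add: add.commute)
    also have "sum h {c * \<tau>..<c * \<tau> + \<tau>} = (\<Sum>t<\<tau>. h (c * \<tau> + t))"
      by (rule sum.reindex_bij_witness[of _ "\<lambda>t. c * \<tau> + t" "\<lambda>i. i - c * \<tau>"]) auto
    finally show ?case using Suc by simp
  qed simp
  then show ?thesis by (subst sum.swap) simp
qed

lemma sum_triples: "(\<Sum>i<3 * \<tau>. h i) = (\<Sum>t<\<tau>. h (3 * t) + h (3 * t + 1) + h (3 * t + 2 :: nat))"
  for h :: "nat \<Rightarrow> nat"
proof (induction \<tau>)
  case (Suc t)
  have "3 * Suc t = Suc (Suc (Suc (3 * t)))" by simp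
  then show ?case using Suc by (simp add: eval_nat_numeral)
qed simp

text \<open>Layer \<open>j * \<tau> + t\<close> decides whether candidate number \<open>j\<close> belongs to committee \<open>t\<close>. For \<open>t = 0\<close> the
  number \<open>change_of c \<tau> f t\<close> compares with the last committee of the preceding candidate; it is
  meaningless and the final check skips it.\<close>

definition gain :: "nat \<Rightarrow> nat \<Rightarrow> (nat \<Rightarrow> nat \<Rightarrow> nat) \<Rightarrow> nat \<Rightarrow> nat" where
  "gain N \<tau> votes i = N ^ (3 * (i mod \<tau>)) + votes (i mod \<tau>) (i div \<tau>) * N ^ (3 * (i mod \<tau>) + 1)"

definition change :: "nat \<Rightarrow> nat \<Rightarrow> nat \<Rightarrow> nat" where
  "change N \<tau> i = N ^ (3 * (i mod \<tau>) + 2)"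

definition size_of :: "nat \<Rightarrow> nat \<Rightarrow> (nat \<Rightarrow> bool) \<Rightarrow> nat \<Rightarrow> nat" where
  "size_of c \<tau> f t = (\<Sum>j<c. of_bool (f (Suc (j * \<tau> + t))))"

definition score_of ::
  "nat \<Rightarrow> nat \<Rightarrow> (nat \<Rightarrow> nat \<Rightarrow> nat) \<Rightarrow> (nat \<Rightarrow> bool) \<Rightarrow> nat \<Rightarrow> nat" where
  "score_of c \<tau> votes f t = (\<Sum>j<c. of_bool (f (Suc (j * \<tau> + t))) * votes t j)"

definition change_of :: "nat \<Rightarrow> nat \<Rightarrow> (nat \<Rightarrow> bool) \<Rightarrow> nat \<Rightarrow> nat" where
  "change_of c \<tau> f t = (\<Sum>j<c. of_bool (f (Suc (j * \<tau> + t)) \<noteq> f (j * \<tau> + t)))"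

definition path_digit ::
  "nat \<Rightarrow> nat \<Rightarrow> (nat \<Rightarrow> nat \<Rightarrow> nat) \<Rightarrow> (nat \<Rightarrow> bool) \<Rightarrow> nat \<Rightarrow> nat" where
  "path_digit c \<tau> votes f i = (if i mod 3 = 0 then size_of c \<tau> f (i div 3)
     else if i mod 3 = 1 then score_of c \<tau> votes f (i div 3) else change_of c \<tau> f (i div 3))"

lemma path_digit_simps:
  "path_digit c \<tau> votes f (3 * t) = size_of c \<tau> f t"
  "path_digit c \<tau> votes f (3 * t + 1) = score_of c \<tau> votes f t"
  "path_digit c \<tau> votes f (3 * t + 2) = change_of c \<tau> f t"
proof -
  have "(3 * t + 1) div 3 = t" "(3 * t + 1) mod 3 = 1" "(3 * t + 2) div 3 = t" "(3 * t + 2) mod 3 = 2"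
    by presburger+
  then show "path_digit c \<tau> votes f (3 * t) = size_of c \<tau> f t" "path_digit c \<tau> votes f (3 * t + 1) = score_of c \<tau> votes f t"
    "path_digit c \<tau> votes f (3 * t + 2) = change_of c \<tau> f t"
    unfolding path_digit_def by simp_all
qed

lemma sum_of_bool_le: "(\<Sum>j<c. of_bool (p j) :: nat) \<le> c"
  using sum_bounded_above[of "{..<c}" "\<lambda>j. of_bool (p j) :: nat" 1] by simp

context
  fixes N c \<tau> :: nat and votes :: "nat \<Rightarrow> nat \<Rightarrow> nat"
  assumes candidates_less: "c < N"
    and votes_less: "t < \<tau> \<Longrightarrow> (\<Sum>j<c. votes t j) < N"
begin

lemma path_digit_less:
  assumes "i < 3 * \<tau>"
  shows "path_digit c \<tau> votes f i < N"
proof -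
  have "i div 3 < \<tau>" using assms by auto
  have "score_of c \<tau> votes f (i div 3) \<le> (\<Sum>j<c. votes (i div 3) j)"
    unfolding score_of_def by (rule sum_mono) simp
  then show ?thesis
    using votes_less[OF \<open>i div 3 < \<tau>\<close>] candidates_less
      sum_of_bool_le[where c=c and p="\<lambda>j. f (Suc (j * \<tau> + i div 3))"]
      sum_of_bool_le[where c=c and p="\<lambda>j. f (Suc (j * \<tau> + i div 3)) \<noteq> f (j * \<tau> + i div 3)"]
    unfolding path_digit_def size_of_def change_of_def by auto
qed

lemma path_sum_digits: "path_sum (gain N \<tau> votes) (change N \<tau>) f (c * \<tau>) = (\<Sum>i<3 * \<tau>. path_digit c \<tau> votes f i * N ^ i)"
proof -
  have "path_sum (gain N \<tau> votes) (change N \<tau>) f (c * \<tau>) = (\<Sum>t<\<tau>. \<Sum>j<c.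
     of_bool (f (Suc (j * \<tau> + t))) * gain N \<tau> votes (j * \<tau> + t) +
     of_bool (f (Suc (j * \<tau> + t)) \<noteq> f (j * \<tau> + t)) * change N \<tau> (j * \<tau> + t))"
    unfolding path_sum_def by (rule sum_rows)
  also have "\<dots> = (\<Sum>t<\<tau>. \<Sum>j<c.
     of_bool (f (Suc (j * \<tau> + t))) * N ^ (3 * t) +
     of_bool (f (Suc (j * \<tau> + t))) * votes t j * N ^ (3 * t + 1) +
     of_bool (f (Suc (j * \<tau> + t)) \<noteq> f (j * \<tau> + t)) * N ^ (3 * t + 2))"
    by (intro sum.cong refl) (auto simp: gain_def change_def)
  also have "\<dots> = (\<Sum>t<\<tau>. size_of c \<tau> f t * N ^ (3 * t) + score_of c \<tau> votes f t * N ^ (3 * t + 1) +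
      change_of c \<tau> f t * N ^ (3 * t + 2))"
    unfolding size_of_def score_of_def change_of_def sum_distrib_right sum.distrib ..
  also have "\<dots> = (\<Sum>i<3 * \<tau>. path_digit c \<tau> votes f i * N ^ i)"
    unfolding sum_triples path_digit_simps ..
  finally show ?thesis .
qed

lemma path_sum_less: "i \<le> c * \<tau> \<Longrightarrow> path_sum (gain N \<tau> votes) (change N \<tau>) f i < N ^ (3 * \<tau>)"
  using path_sum_mono[of i "c * \<tau>" "gain N \<tau> votes" "change N \<tau>" f] path_sum_digits[of f]
    sum_digits_less[of "3 * \<tau>" "path_digit c \<tau> votes f" N] path_digit_less by simp

lemma layers_path_sum:
  "j \<le> c * \<tau> \<Longrightarrow> layers (N ^ (3 * \<tau>)) (gain N \<tau> votes) (change N \<tau>) j =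
     {of_bool (f j) * N ^ (3 * \<tau>) + path_sum (gain N \<tau> votes) (change N \<tau>) f j | f. \<not> f 0}"
  by (rule layers_eq) (simp add: path_sum_less)

lemma layers_bounded: "j \<le> c * \<tau> \<Longrightarrow> layers (N ^ (3 * \<tau>)) (gain N \<tau> votes) (change N \<tau>) j \<subseteq> {..<2 * N ^ (3 * \<tau>)}"
proof
  fix v assume j: "j \<le> c * \<tau>" and "v \<in> layers (N ^ (3 * \<tau>)) (gain N \<tau> votes) (change N \<tau>) j"
  then obtain f where "v = of_bool (f j) * N ^ (3 * \<tau>) + path_sum (gain N \<tau> votes) (change N \<tau>) f j"
    unfolding layers_path_sum[OF j] by blast
  then show "v \<in> {..<2 * N ^ (3 * \<tau>)}"
    using path_sum_less[OF j, of f] by (cases "f j") auto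
qed

lemma digit_path:
  assumes "v = of_bool b * N ^ (3 * \<tau>) + path_sum (gain N \<tau> votes) (change N \<tau>) f (c * \<tau>)" "t < \<tau>"
  shows "digit N v (3 * t) = size_of c \<tau> f t" "digit N v (3 * t + 1) = score_of c \<tau> votes f t"
    "digit N v (3 * t + 2) = change_of c \<tau> f t"
proof -
  have "digit N v i = path_digit c \<tau> votes f i" if "i < 3 * \<tau>" for i
    unfolding assms(1) path_sum_digits by (rule digit_sum[OF path_digit_less that])
  from this[of "3 * t"] this[of "3 * t + 1"] this[of "3 * t + 2"] show
    "digit N v (3 * t) = size_of c \<tau> f t" "digit N v (3 * t + 1) = score_of c \<tau> votes f t"
    "digit N v (3 * t + 2) = change_of c \<tau> f t"
    using assms(2) unfolding path_digit_simps by simp_all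
qed

end

section \<open>Committees as sequences of decisions\<close>

definition ballots :: "mpv \<Rightarrow> nat \<Rightarrow> nat \<Rightarrow> nat" where
  "ballots I t j =
     card {a \<in> agents I. (profiles I ! t) a = Some (sorted_list_of_set (candidates I) ! j)}"

lemma card_Collect_less_of_bool: "(\<Sum>j<(c::nat). of_bool (p j)) = card {j. j < c \<and> p j}"
  by (induction c) (simp_all add: card_less_Suc_Collect)

lemma sum_of_bool_mult: "(\<Sum>j<c. of_bool (p j) * h j) = (\<Sum>j | j < c \<and> p j. h j)" for h :: "nat \<Rightarrow> nat"
proof -
  have "(\<Sum>j<c. of_bool (p j) * h j) = (\<Sum>j<c. if p j then h j else 0)"
    by (rule sum.cong) auto
  also have "\<dots> = (\<Sum>j\<in>{j \<in> {..<c}. p j}. h j)"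
    by (rule sum.inter_filter[symmetric]) simp
  finally show ?thesis by simp
qed

definition good_choice :: "bool \<Rightarrow> mpv \<Rightarrow> (nat \<Rightarrow> bool) \<Rightarrow> nat \<Rightarrow> bool" where
  "good_choice b I f t \<longleftrightarrow> (let c = card (candidates I); \<tau> = length (profiles I) in
     size_of c \<tau> f t \<le> k_bound I \<and> x_bound I \<le> score_of c \<tau> (ballots I) f t \<and>
     (0 < t \<longrightarrow> (if b then change_of c \<tau> f t \<le> l_bound I else l_bound I \<le> change_of c \<tau> f t)))"

context
  fixes I :: mpv and cs :: "nat list" and c \<tau> :: nat
  assumes I: "mpv_instance I"
  defines "cs \<equiv> sorted_list_of_set (candidates I)" and "c \<equiv> card (candidates I)"
    and "\<tau> \<equiv> length (profiles I)"
begin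

lemma inj_cs: "inj_on ((!) cs) {..<c}"
  using inj_on_nth[of cs "{..<c}"] by (simp add: cs_def c_def)

lemma cs_image: "(!) cs ` {..<c} = candidates I"
proof -
  have "(!) cs ` {..<c} = set cs"
    unfolding set_conv_nth by (auto simp: cs_def c_def)
  then show ?thesis using I by (simp add: cs_def mpv_instance_def)
qed

lemma score_cs_image:
  assumes "J \<subseteq> {..<c}"
  shows "score I t ((!) cs ` J) = (\<Sum>j\<in>J. ballots I t j)"
proof -
  let ?B = "\<lambda>j. {a \<in> agents I. (profiles I ! t) a = Some (cs ! j)}"
  have fin: "finite (agents I)" using I by (simp add: mpv_instance_def)
  have "finite J" using assms finite_subset by blast
  have "{a \<in> agents I. (profiles I ! t) a \<in> Some ` (!) cs ` J} = (\<Union>j\<in>J. ?B j)"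
    by auto
  then have "score I t ((!) cs ` J) = card (\<Union>j\<in>J. ?B j)"
    by (simp add: score_def)
  also have "\<dots> = (\<Sum>j\<in>J. card (?B j))"
  proof (rule card_UN_disjoint[OF \<open>finite J\<close>])
    show "\<forall>i\<in>J. \<forall>j\<in>J. i \<noteq> j \<longrightarrow> ?B i \<inter> ?B j = {}"
      using inj_onD[OF inj_on_subset[OF inj_cs assms]] by fastforce
  qed (use fin in auto)
  finally show ?thesis by (simp add: ballots_def cs_def)
qed

lemma sum_ballots_le: "(\<Sum>j<c. ballots I t j) \<le> card (agents I)"
proof -
  have "score I t ((!) cs ` {..<c}) \<le> card (agents I)"
    unfolding score_def using I by (intro card_mono) (auto simp: mpv_instance_def)
  then show ?thesis by (simp add: score_cs_image)
qed

definition committee :: "(nat \<Rightarrow> bool) \<Rightarrow> nat \<Rightarrow> nat set" where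
  "committee f t = (!) cs ` {j. j < c \<and> f (Suc (j * \<tau> + t))}"

lemma card_committee: "card (committee f t) = size_of c \<tau> f t"
proof -
  have "card (committee f t) = card {j. j < c \<and> f (Suc (j * \<tau> + t))}"
    unfolding committee_def by (intro card_image inj_on_subset[OF inj_cs]) auto
  then show ?thesis by (simp add: size_of_def card_Collect_less_of_bool)
qed

lemma score_committee: "score I t (committee f t) = score_of c \<tau> (ballots I) f t"
  unfolding committee_def score_of_def sum_of_bool_mult by (rule score_cs_image) auto

lemma card_sym_diff_committee:
  "card (sym_diff (committee f t) (committee f (Suc t))) = change_of c \<tau> f (Suc t)"
proof -
  let ?A = "{j. j < c \<and> f (Suc (j * \<tau> + t))}" and ?B = "{j. j < c \<and> f (Suc (j * \<tau> + Suc t))}"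
  have "sym_diff (committee f t) (committee f (Suc t)) = (!) cs ` sym_diff ?A ?B"
  proof -
    have "(!) cs ` (?A - ?B) = (!) cs ` ?A - (!) cs ` ?B"
      by (rule inj_on_image_set_diff[OF inj_cs]) auto
    moreover have "(!) cs ` (?B - ?A) = (!) cs ` ?B - (!) cs ` ?A"
      by (rule inj_on_image_set_diff[OF inj_cs]) auto
    ultimately show ?thesis by (simp only: committee_def image_Un)
  qed
  moreover have "card ((!) cs ` sym_diff ?A ?B) = card (sym_diff ?A ?B)"
    by (intro card_image inj_on_subset[OF inj_cs]) auto
  moreover have "sym_diff ?A ?B = {j. j < c \<and> f (Suc (j * \<tau> + Suc t)) \<noteq> f (j * \<tau> + Suc t)}"
    by auto
  ultimately show ?thesis by (simp add: change_of_def card_Collect_less_of_bool)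
qed

lemma ex_choice_committee:
  assumes "\<And>t. t < \<tau> \<Longrightarrow> Cs ! t \<subseteq> candidates I"
  obtains f where "\<not> f 0" "\<And>t. t < \<tau> \<Longrightarrow> committee f t = Cs ! t"
proof -
  define f where "f i \<longleftrightarrow> 0 < i \<and> cs ! ((i - 1) div \<tau>) \<in> Cs ! ((i - 1) mod \<tau>)" for i
  have "committee f t = Cs ! t" if "t < \<tau>" for t
  proof -
    have "f (Suc (j * \<tau> + t)) \<longleftrightarrow> cs ! j \<in> Cs ! t" for j
      using that by (simp add: f_def)
    then show ?thesis
      unfolding committee_def using assms[OF that] unfolding cs_image[symmetric] by auto
  qed
  moreover have "\<not> f 0" by (simp add: f_def)
  ultimately show thesis by (rule that[rotated])
qed

lemma yes_iff_good_choice: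
  "(if b then cmpv_yes I else rmpv_yes I) \<longleftrightarrow> (\<exists>f. \<not> f 0 \<and> (\<forall>t < \<tau>. good_choice b I f t))"
proof -
  define rel where "rel n \<longleftrightarrow> (if b then n \<le> l_bound I else l_bound I \<le> n)" for n
  define yes where "yes Cs \<longleftrightarrow> committees I Cs \<and>
     (\<forall>t. Suc t < \<tau> \<longrightarrow> rel (card (sym_diff (Cs ! t) (Cs ! Suc t))))" for Cs
  have good: "good_choice b I f t \<longleftrightarrow> card (committee f t) \<le> k_bound I \<and>
      x_bound I \<le> score I t (committee f t) \<and>
      (\<forall>s. t = Suc s \<longrightarrow> rel (card (sym_diff (committee f s) (committee f t))))" for f t
    unfolding good_choice_def card_committee score_committee Let_def c_def[symmetric] \<tau>_def[symmetric]
    by (cases t) (auto simp: card_sym_diff_committee rel_def)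
  have "(if b then cmpv_yes I else rmpv_yes I) \<longleftrightarrow> (\<exists>Cs. yes Cs)"
    by (simp add: cmpv_yes_def rmpv_yes_def yes_def rel_def \<tau>_def)
  also have "\<dots> \<longleftrightarrow> (\<exists>f. \<not> f 0 \<and> (\<forall>t < \<tau>. good_choice b I f t))"
  proof
    assume "\<exists>Cs. yes Cs"
    then obtain Cs where Cs: "yes Cs" by blast
    then have "\<And>t. t < \<tau> \<Longrightarrow> Cs ! t \<subseteq> candidates I"
      by (simp add: yes_def committees_def \<tau>_def)
    then obtain f where f: "\<not> f 0" "\<And>t. t < \<tau> \<Longrightarrow> committee f t = Cs ! t"
      using ex_choice_committee by metis
    have "good_choice b I f t" if "t < \<tau>" for t
      unfolding good using Cs f(2) that
      by (auto simp: yes_def committees_def \<tau>_def)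
    then show "\<exists>f. \<not> f 0 \<and> (\<forall>t < \<tau>. good_choice b I f t)" using f(1) by blast
  next
    assume "\<exists>f. \<not> f 0 \<and> (\<forall>t < \<tau>. good_choice b I f t)"
    then obtain f where f: "\<forall>t < \<tau>. good_choice b I f t" by blast
    have "committee f t \<subseteq> candidates I" for t
      unfolding committee_def cs_image[symmetric] by auto
    then have "yes (map (committee f) [0..<\<tau>])"
      using f unfolding yes_def committees_def good by (auto simp: \<tau>_def)
    then show "\<exists>Cs. yes Cs" by blast
  qed
  finally show ?thesis .
qed

end

section \<open>The decision procedure\<close>

lemma computable_times_16: "computable (\<lambda>n. 16 * n)"
  unfolding computable_def
proof (intro exI allI)
  let ?p = "replicate 4 (Add 0 0 0)"
  fix n
  show "halted ?p (run ?p 4 (init_nat n)) \<and> reg (run ?p 4 (init_nat n)) 0 = 16 * n"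
    by (simp add: eval_nat_numeral run_Suc step_def halted_def init_nat_def)
qed

lemma answers_within_compile:
  assumes "wp c (\<lambda>n r' m'. n \<le> T \<and> (r' 0 \<noteq> 0 \<longleftrightarrow> b)) (reg (init_word w)) (mem (init_word w))"
  shows "answers_within (compile 0 c) w T b"
proof -
  let ?P = "compile 0 c"
  obtain n r' m' where n: "big_step c (reg (init_word w)) (mem (init_word w)) n r' m'"
    "n \<le> T" "r' 0 \<noteq> 0 \<longleftrightarrow> b"
    using assms unfolding wp_def by blast
  have init: "init_word w = cfg 0 (reg (init_word w)) (mem (init_word w))"
    by (simp add: init_word_def)
  have "code_at ?P 0 ?P" by (simp add: code_at_def)
  from compile_correct[OF n(1) this]
  have "run ?P n (init_word w) = cfg (code_size c) r' m'" using init by simp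
  moreover have "halted ?P (cfg (code_size c) r' m')" by (simp add: halted_def)
  ultimately have "run ?P (n + (T - n)) (init_word w) = cfg (code_size c) r' m'"
    by (simp only: run_add run_halted)
  then show ?thesis
    using n(2,3) \<open>halted ?P _\<close> by (simp add: answers_within_def)
qed

definition numbers :: "mpv \<Rightarrow> nat list" where
  "numbers I = card (agents I) # sorted_list_of_set (agents I) @
     card (candidates I) # sorted_list_of_set (candidates I) @
     length (profiles I) #
     concat (map (\<lambda>u. map (\<lambda>a. encode_vote (u a)) (sorted_list_of_set (agents I))) (profiles I)) @
     [k_bound I, l_bound I, x_bound I]"

lemma length_concat_rows: "length (concat (map (\<lambda>u. map (h u) as) us)) = length us * length as"
  by (induction us) auto

lemma nth_concat_rows:
  assumes "t < length us" "i < length as"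
  shows "concat (map (\<lambda>u. map (h u) as) us) ! (t * length as + i) = h (us ! t) (as ! i)"
  using assms(1)
proof (induction us arbitrary: t)
  case (Cons u us)
  then show ?case using assms(2) by (cases t) (auto simp: nth_append)
qed simp

lemma numbers_nth:
  fixes I
  defines "a \<equiv> card (agents I)" and "c \<equiv> card (candidates I)" and "\<tau> \<equiv> length (profiles I)"
  shows "numbers I ! 0 = a" "numbers I ! (1 + a) = c"
    "\<And>j. j < c \<Longrightarrow> numbers I ! (2 + a + j) = sorted_list_of_set (candidates I) ! j"
    "numbers I ! (2 + a + c) = \<tau>"
    "\<And>t i. t < \<tau> \<Longrightarrow> i < a \<Longrightarrow> numbers I ! (3 + a + c + t * a + i) =
       encode_vote ((profiles I ! t) (sorted_list_of_set (agents I) ! i))"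
    "numbers I ! (3 + a + c + \<tau> * a) = k_bound I" "numbers I ! (4 + a + c + \<tau> * a) = l_bound I"
    "numbers I ! (5 + a + c + \<tau> * a) = x_bound I"
    "length (numbers I) = 6 + a + c + \<tau> * a"
proof -
  define as cs where "as = sorted_list_of_set (agents I)" and "cs = sorted_list_of_set (candidates I)"
  define vs where "vs = concat (map (\<lambda>u. map (\<lambda>a. encode_vote (u a)) as) (profiles I))"
  have len: "length as = a" "length cs = c" by (simp_all add: as_def cs_def a_def c_def)
  have lv: "length vs = \<tau> * a" by (simp add: vs_def length_concat_rows len \<tau>_def)
  define R3 where "R3 = [k_bound I, l_bound I, x_bound I]"
  define R2 where "R2 = \<tau> # vs @ R3"
  define R1 where "R1 = c # cs @ R2"
  have nums: "numbers I = a # as @ R1"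
    by (simp add: numbers_def a_def c_def \<tau>_def R1_def R2_def R3_def as_def cs_def vs_def)
  have n1: "numbers I ! (1 + a + i) = R1 ! i" for i
    unfolding nums using nth_append_length_plus[of as R1 i] by (simp add: len)
  have n2: "R1 ! (1 + c + i) = R2 ! i" for i
    unfolding R1_def using nth_append_length_plus[of cs R2 i] by (simp add: len)
  have n3: "R2 ! (1 + \<tau> * a + i) = R3 ! i" for i
    unfolding R2_def using nth_append_length_plus[of vs R3 i] by (simp add: lv)
  have n12: "numbers I ! (2 + a + c + i) = R2 ! i" for i
    using n1[of "1 + c + i"] n2[of i] by (simp add: add_ac)
  have n123: "numbers I ! (3 + a + c + \<tau> * a + i) = R3 ! i" for i
    using n12[of "1 + \<tau> * a + i"] n3[of i] by (simp add: add_ac numeral_3_eq_3)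
  show "numbers I ! 0 = a" by (simp add: nums)
  show "numbers I ! (1 + a) = c" using n1[of 0] by (simp add: R1_def)
  show "numbers I ! (2 + a + j) = sorted_list_of_set (candidates I) ! j" if "j < c" for j
    using n1[of "1 + j"] that by (simp add: R1_def nth_append len cs_def[symmetric])
  show "numbers I ! (2 + a + c) = \<tau>" using n12[of 0] by (simp add: R2_def)
  show "numbers I ! (3 + a + c + t * a + i) =
       encode_vote ((profiles I ! t) (sorted_list_of_set (agents I) ! i))" if "t < \<tau>" "i < a" for t i
  proof -
    have "(t + 1) * a \<le> \<tau> * a" using that(1) by (intro mult_le_mono1) simp
    then have "t * a + i < length vs" using that(2) lv by simp
    then show ?thesis
      using n12[of "1 + (t * a + i)"] nth_concat_rows[of t "profiles I" i as "\<lambda>u a. encode_vote (u a)"] that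
      by (simp add: R2_def nth_append len \<tau>_def vs_def as_def[symmetric] add_ac numeral_3_eq_3)
  qed
  show "numbers I ! (3 + a + c + \<tau> * a) = k_bound I" "numbers I ! (4 + a + c + \<tau> * a) = l_bound I"
    "numbers I ! (5 + a + c + \<tau> * a) = x_bound I"
    using n123[of 0] n123[of 1] n123[of 2] by (simp_all add: R3_def add_ac eval_nat_numeral)
  show "length (numbers I) = 6 + a + c + \<tau> * a"
    by (simp add: nums R1_def R2_def R3_def len lv)
qed

lemma encode_mpv_numbers: "encode_mpv I = concat (map encode_nat (numbers I))"
  unfolding encode_mpv_def numbers_def ..

lemma length_encode_mpv:
  assumes "mpv_instance I"
  shows "12 \<le> length (encode_mpv I)" "length (numbers I) \<le> length (encode_mpv I)"
proof -
  have pos: "3 \<le> length (encode_nat n)" if "n \<ge> 1" for n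
    using that by (subst length_encode_nat, subst binary.simps) simp
  have one: "1 \<le> length (encode_nat n)" for n
    by (simp add: length_encode_nat)
  show "12 \<le> length (encode_mpv I)"
  proof -
    have "length (encode_nat (card (agents I))) + length (encode_nat (card (candidates I))) +
        length (encode_nat (length (profiles I))) + length (encode_nat (k_bound I)) +
        length (encode_nat (l_bound I)) + length (encode_nat (x_bound I)) \<le> length (encode_mpv I)"
      by (simp add: encode_mpv_def)
    moreover have "1 \<le> length (profiles I)" "1 \<le> k_bound I" "1 \<le> x_bound I"
      using assms by (auto simp: mpv_instance_def Suc_le_eq)
    ultimately show ?thesis
      using pos[of "length (profiles I)"] pos[of "k_bound I"] pos[of "x_bound I"]
        one[of "card (agents I)"] one[of "card (candidates I)"] one[of "l_bound I"]
      by linarith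
  qed
  have "length xs \<le> length (concat (map encode_nat xs))" for xs
    by (induction xs) (auto simp: length_encode_nat)
  then show "length (numbers I) \<le> length (encode_mpv I)"
    by (simp add: encode_mpv_numbers)
qed

lemma card_encoded_votes:
  assumes "mpv_instance I"
  shows "card {i. i < card (agents I) \<and>
      encode_vote ((profiles I ! t) (sorted_list_of_set (agents I) ! i)) =
      Suc (sorted_list_of_set (candidates I) ! j)} = ballots I t j"
proof -
  define as where "as = sorted_list_of_set (agents I)"
  have as: "set as = agents I" "distinct as" "length as = card (agents I)"
    using assms by (simp_all add: as_def mpv_instance_def)
  have ev: "encode_vote v = Suc y \<longleftrightarrow> v = Some y" for v y
    by (simp add: encode_vote_def split: option.split)
  let ?J = "{i. i < length as \<and> (profiles I ! t) (as ! i) = Some (sorted_list_of_set (candidates I) ! j)}"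
  have "(!) as ` ?J = {a \<in> agents I. (profiles I ! t) a = Some (sorted_list_of_set (candidates I) ! j)}"
    unfolding as(1)[symmetric] set_conv_nth by auto
  moreover have "card ((!) as ` ?J) = card ?J"
    using as(2) by (intro card_image inj_on_nth) auto
  ultimately show ?thesis
    unfolding ballots_def ev by (simp add: as_def)
qed

lemma total_time:
  fixes N a c \<tau> :: nat
  assumes "12 \<le> N" "1 \<le> \<tau>" "a \<le> N" "c \<le> N"
  defines "w \<equiv> N ^ (3 * \<tau>)"
  shows "(N * (8 * N + 9) + 9) + (\<tau> * (12 * N + 22) + 30) +
    (c * (\<tau> * (12 * N + 10 * a + 22 * w + 42) + 12) + 7) + (2 * w * (\<tau> * (36 * w + 52) + 20) + 6)
    \<le> N ^ (16 * \<tau>)"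
proof -
  have "N ^ 1 \<le> w" unfolding w_def using assms by (intro power_increasing) auto
  then have N: "N \<le> w" by simp
  \<comment> \<open>Without agents \<open>\<tau>\<close> is not bounded by the input length, as it is written in binary.\<close>
  have "\<tau> \<le> 2 ^ \<tau>" using less_exp[of \<tau>] by simp
  also have "(2::nat) ^ \<tau> \<le> N ^ \<tau>" using assms by (intro power_mono) auto
  also have "\<dots> \<le> w" unfolding w_def using assms by (intro power_increasing) auto
  finally have t: "\<tau> \<le> w" .
  have w1: "1 \<le> w" using N assms by simp
  have w2: "w \<le> w * w" using w1 by simp
  have w3: "w * w \<le> w * w * w" using w1 by simp
  have "N * (8 * N + 9) \<le> w * (8 * w + 9 * w)"
    using N w1 by (intro mult_le_mono) auto
  then have "N * (8 * N + 9) \<le> 17 * (w * w)"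
    by (simp add: algebra_simps)
  then have 1: "N * (8 * N + 9) \<le> 17 * (w * w * w)"
    using w3 by linarith
  have "\<tau> * (12 * N + 22) \<le> w * (12 * w + 22 * w)"
    using N w1 t by (intro mult_le_mono) auto
  then have "\<tau> * (12 * N + 22) \<le> 34 * (w * w)"
    by (simp add: algebra_simps)
  then have 2: "\<tau> * (12 * N + 22) \<le> 34 * (w * w * w)"
    using w3 by linarith
  have "\<tau> * (12 * N + 10 * a + 22 * w + 42) \<le> w * (12 * w + 10 * w + 22 * w + 42 * w)"
    using N w1 t assms(3) by (intro mult_le_mono) auto
  then have "\<tau> * (12 * N + 10 * a + 22 * w + 42) \<le> 86 * (w * w)"
    by (simp add: algebra_simps)
  then have "\<tau> * (12 * N + 10 * a + 22 * w + 42) + 12 \<le> 98 * (w * w)"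
    using w1 w2 by linarith
  then have "c * (\<tau> * (12 * N + 10 * a + 22 * w + 42) + 12) \<le> w * (98 * (w * w))"
    using N assms(4) by (intro mult_le_mono) auto
  then have 3: "c * (\<tau> * (12 * N + 10 * a + 22 * w + 42) + 12) \<le> 98 * (w * w * w)"
    by (simp add: algebra_simps)
  have "\<tau> * (36 * w + 52) \<le> w * (36 * w + 52 * w)"
    using w1 t by (intro mult_le_mono) auto
  then have "\<tau> * (36 * w + 52) \<le> 88 * (w * w)"
    by (simp add: algebra_simps)
  then have "\<tau> * (36 * w + 52) + 20 \<le> 108 * (w * w)"
    using w1 w2 by linarith
  then have "2 * w * (\<tau> * (36 * w + 52) + 20) \<le> 2 * w * (108 * (w * w))"
    by (intro mult_le_mono) auto
  then have 4: "2 * w * (\<tau> * (36 * w + 52) + 20) \<le> 216 * (w * w * w)"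
    by (simp add: algebra_simps)
  have 5: "1 \<le> w * w * w" using w1 w2 w3 by linarith
  have "12 ^ 3 * (w * w * w) \<le> N ^ 3 * (w * w * w)"
    using assms(1) by (intro mult_le_mono1 power_mono) auto
  also have "\<dots> = N ^ (3 + 9 * \<tau>)"
    by (simp add: w_def power_add[symmetric])
  also have "\<dots> \<le> N ^ (16 * \<tau>)"
    using assms by (intro power_increasing) auto
  finally have "1728 * (w * w * w) \<le> N ^ (16 * \<tau>)" by simp
  then show ?thesis using 1 2 3 4 5 by linarith
qed

definition mpv_program :: "bool \<Rightarrow> com" where
  "mpv_program b = parse ;; setup_vars ;; dp ;; final b"

lemma layers_good_choice:
  assumes I: "mpv_instance I"
  defines "N \<equiv> length (encode_mpv I)" and "c \<equiv> card (candidates I)" and "\<tau> \<equiv> length (profiles I)"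
  defines "L \<equiv> layers (N ^ (3 * \<tau>)) (gain N \<tau> (ballots I)) (change N \<tau>)"
  shows "(\<exists>v \<in> L (c * \<tau>). v < 2 * N ^ (3 * \<tau>) \<and>
      (\<forall>t < \<tau>. digits_ok b N (k_bound I) (l_bound I) (x_bound I) v t)) \<longleftrightarrow>
      (if b then cmpv_yes I else rmpv_yes I)"
    and "j \<le> c * \<tau> \<Longrightarrow> L j \<subseteq> {..<2 * N ^ (3 * \<tau>)}"
proof -
  have "length (numbers I) \<le> N" using length_encode_mpv[OF I] by (simp add: N_def)
  then have less: "c < N" "card (agents I) < N"
    using numbers_nth(9)[of I] by (simp_all add: c_def)
  have votes: "(\<Sum>j<c. ballots I t j) < N" for t
    using sum_ballots_le[OF I, of t] less by (simp add: c_def)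
  show b: "j \<le> c * \<tau> \<Longrightarrow> L j \<subseteq> {..<2 * N ^ (3 * \<tau>)}" for j
    unfolding L_def using layers_bounded[OF less(1) votes] .
  let ?v = "\<lambda>f. of_bool (f (c * \<tau>)) * N ^ (3 * \<tau>) + path_sum (gain N \<tau> (ballots I)) (change N \<tau>) f (c * \<tau>)"
  have L: "L (c * \<tau>) = {?v f | f. \<not> f 0}"
    unfolding L_def using layers_path_sum[OF less(1) votes order.refl] .
  have ok: "digits_ok b N (k_bound I) (l_bound I) (x_bound I) (?v f) t \<longleftrightarrow> good_choice b I f t"
    if "t < \<tau>" for f t
    unfolding digits_ok_def good_choice_def Let_def digit_path[OF less(1) votes refl that]
    by (simp add: c_def \<tau>_def)
  have "(\<exists>v \<in> L (c * \<tau>). v < 2 * N ^ (3 * \<tau>) \<and>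
      (\<forall>t < \<tau>. digits_ok b N (k_bound I) (l_bound I) (x_bound I) v t)) \<longleftrightarrow>
      (\<exists>v \<in> L (c * \<tau>). \<forall>t < \<tau>. digits_ok b N (k_bound I) (l_bound I) (x_bound I) v t)"
    using b[of "c * \<tau>"] by blast
  also have "\<dots> \<longleftrightarrow> (\<exists>f. \<not> f 0 \<and> (\<forall>t < \<tau>. good_choice b I f t))"
    unfolding L using ok by blast
  also have "\<dots> \<longleftrightarrow> (if b then cmpv_yes I else rmpv_yes I)"
    using yes_iff_good_choice[OF I, of b] by (simp add: \<tau>_def)
  finally show "(\<exists>v \<in> L (c * \<tau>). v < 2 * N ^ (3 * \<tau>) \<and>
      (\<forall>t < \<tau>. digits_ok b N (k_bound I) (l_bound I) (x_bound I) v t)) \<longleftrightarrow>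
      (if b then cmpv_yes I else rmpv_yes I)" .
qed

lemma wp_mpv_program:
  assumes I: "mpv_instance I"
  defines "w \<equiv> encode_mpv I"
  shows "wp (mpv_program b) (\<lambda>n r' m'. n \<le> length w ^ (16 * length (profiles I)) \<and>
     (r' 0 \<noteq> 0 \<longleftrightarrow> (if b then cmpv_yes I else rmpv_yes I))) (reg (init_word w)) (mem (init_word w))"
proof -
  define N a c \<tau> where "N = length w" and "a = card (agents I)" and "c = card (candidates I)"
    and "\<tau> = length (profiles I)"
  define W where "W = N ^ (3 * \<tau>)"
  define m0 where "m0 = (\<lambda>i. if length w \<le> i \<and> i < length w + length (numbers I)
      then numbers I ! (i - length w) else mem (init_word w) i)"
  note len = length_encode_mpv[OF I, folded w_def N_def]
  note nth = numbers_nth[where I=I, folded a_def c_def \<tau>_def]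
  have w: "w = concat (map encode_nat (numbers I))"
    by (simp add: w_def encode_mpv_numbers)
  have m0: "m0 (N + i) = numbers I ! i" if "i < 6 + a + c + \<tau> * a" for i
    using that nth(9) by (simp add: m0_def N_def)
  have m0_zero: "m0 x = 0" if "2 * N \<le> x" for x
    using that len by (simp add: m0_def N_def init_word_def)
  have tau: "1 \<le> \<tau>" using I by (simp add: \<tau>_def mpv_instance_def Suc_le_eq)
  have ac: "a \<le> N" "c \<le> N" using len(2) nth(9) by simp_all
  have vote_addr: "t * a + i < \<tau> * a" if "t < \<tau>" "i < a" for t i
  proof -
    have "(t + 1) * a \<le> \<tau> * a" using that(1) by (intro mult_le_mono1) simp
    then show ?thesis using that(2) by simp
  qed
  have gain: "gain N \<tau> (ballots I) (j * \<tau> + t) = N ^ (3 * t) +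
      card {i. i < a \<and> m0 (N + 3 + a + c + t * a + i) = Suc (m0 (N + 2 + a + j))} * N ^ (3 * t + 1)"
    if "j < c" "t < \<tau>" for j t
  proof -
    have "m0 (N + 3 + a + c + t * a + i) = encode_vote ((profiles I ! t) (sorted_list_of_set (agents I) ! i))"
      if "i < a" for i
      using m0[of "3 + a + c + t * a + i"] nth(5)[OF \<open>t < \<tau>\<close> that] vote_addr[OF \<open>t < \<tau>\<close> that]
      by (simp add: add_ac)
    moreover have "m0 (N + 2 + a + j) = sorted_list_of_set (candidates I) ! j"
      using m0[of "2 + a + j"] nth(3)[OF \<open>j < c\<close>] \<open>j < c\<close> by (simp add: add_ac)
    ultimately have "{i. i < a \<and> m0 (N + 3 + a + c + t * a + i) = Suc (m0 (N + 2 + a + j))} =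
       {i. i < a \<and> encode_vote ((profiles I ! t) (sorted_list_of_set (agents I) ! i)) =
          Suc (sorted_list_of_set (candidates I) ! j)}"
      by auto
    then show ?thesis
      using card_encoded_votes[OF I, of t j] that by (simp add: gain_def a_def)
  qed
  have change: "change N \<tau> (j * \<tau> + t) = N ^ (3 * t + 2)" if "t < \<tau>" for j t
    using that by (simp add: change_def)
  let ?L = "layers W (gain N \<tau> (ballots I)) (change N \<tau>)"
  note lay = layers_good_choice[OF I, folded w_def, folded N_def c_def \<tau>_def, folded W_def]
  have setup_spec: "wp setup_vars (\<lambda>n r' m'. n \<le> \<tau> * (12 * N + 22) + 30 \<and> r' rOne = 1 \<and> r' rN = N \<and> r' rA = a \<and>
    r' rM = c \<and> r' rTau = \<tau> \<and> r' rCB = N + 2 + a \<and> r' rVB = N + 3 + a + c \<and> r' rK = k_bound I \<and>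
    r' rL = l_bound I \<and> r' rX = x_bound I \<and> r' rW = N ^ (3 * \<tau>) \<and> m' = m0) r m"
    if "r rOne = 1" "r rN = N" "m = m0" for r m
    unfolding that(3) using that(1,2)
    by (rule wp_setup_vars)
      (use m0[of 0] m0[of "1 + a"] m0[of "2 + a + c"] m0[of "3 + a + c + \<tau> * a"] m0[of "4 + a + c + \<tau> * a"]
        m0[of "5 + a + c + \<tau> * a"] nth in \<open>simp_all add: add_ac\<close>)
  have dp_spec: "wp dp (\<lambda>n r' m'. n \<le> c * (\<tau> * (12 * N + 10 * a + 22 * W + 42) + 12) + 7 \<and>
      table m' (r' rP) (?L (c * \<tau>))) r m"
    if "r rOne = 1" "r rN = N" "r rW = W" "r rA = a" "r rTau = \<tau>" "r rM = c"
      "r rCB = N + 2 + a" "r rVB = N + 3 + a + c" "m = m0" for r m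
    unfolding that(9) using that(1-6) m0_zero
  proof (rule wp_dp)
    show "?L j \<subseteq> {..<2 * W}" if "j < c * \<tau>" for j
      using lay(2)[of j] that by simp
    show "r rVB + \<tau> * a \<le> 2 * N" "r rCB + c \<le> 2 * N"
      using len(2) nth(9) that by simp_all
  qed (use gain change that in simp_all)
  have final_spec: "wp (final b) (\<lambda>n r' m'. n \<le> 2 * W * (\<tau> * (36 * W + 52) + 20) + 6 \<and>
      (r' 0 \<noteq> 0 \<longleftrightarrow> (if b then cmpv_yes I else rmpv_yes I))) r m"
    if "r rOne = 1" "r rN = N" "r rTau = \<tau>" "r rK = k_bound I" "r rL = l_bound I" "r rX = x_bound I"
      "r rW = W" "table m (r rP) (?L (c * \<tau>))" for r m
    using wp_final[OF that(1,2) _ that(3-8), of b] len(1) unfolding lay(1) by simp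
  note time = total_time[OF len(1) tau ac, folded W_def]
  have parse_spec: "wp parse (\<lambda>n r' m'. n \<le> N * (8 * N + 9) + 9 \<and> r' rN = N \<and> r' rOne = 1 \<and> m' = m0)
      (reg (init_word w)) (mem (init_word w))"
    using wp_parse[of "reg (init_word w)" "numbers I" "mem (init_word w)", folded w]
    unfolding m0_def N_def by (simp add: init_word_def)
  show ?thesis
    unfolding mpv_program_def wp_Seq
    apply (rule wp_mono[OF parse_spec])
    subgoal for n1 r1 m1
      apply (rule wp_mono[OF setup_spec[of r1 m1]])
         apply blast+
      subgoal for n2 r2 m2
        apply (rule wp_mono[OF dp_spec[of r2 m2]])
                 apply (simp_all add: W_def)[9]
        subgoal for n3 r3 m3
          apply (rule wp_mono[OF final_spec[of r3 m3]])
                  apply (simp_all add: W_def)[8]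
          using time unfolding N_def[symmetric] \<tau>_def[symmetric] by simp
        done
      done
    done
qed

theorem theorem22: "CMPV \<in> XP \<and> RMPV \<in> XP"
proof
  show "CMPV \<in> XP"
    unfolding XP_def mem_Collect_eq
  proof (intro exI conjI ballI)
    show "computable (\<lambda>n. 16 * n)" by (rule computable_times_16)
    fix I assume "I \<in> instances CMPV"
    then have "mpv_instance I" by (simp add: CMPV_def)
    from answers_within_compile[OF wp_mpv_program[OF this, of True]] this
    show "answers_within (compile 0 (mpv_program True)) (encoding CMPV I)
        (length (encoding CMPV I) ^ (16 * parameter CMPV I)) (I \<in> yes_instances CMPV)"
      by (simp add: CMPV_def)
  qed
  show "RMPV \<in> XP"
    unfolding XP_def mem_Collect_eq
  proof (intro exI conjI ballI)
    show "computable (\<lambda>n. 16 * n)" by (rule computable_times_16)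
    fix I assume "I \<in> instances RMPV"
    then have "mpv_instance I" by (simp add: RMPV_def)
    from answers_within_compile[OF wp_mpv_program[OF this, of False]] this
    show "answers_within (compile 0 (mpv_program False)) (encoding RMPV I)
        (length (encoding RMPV I) ^ (16 * parameter RMPV I)) (I \<in> yes_instances RMPV)"
      by (simp add: RMPV_def)
  qed
qed

end
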